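(* Let $\bar A$ be an $n\times n$ real matrix satisfying $\|\bar A\|_2\le 1$, and let $A$ be a Gaussian perturbation of $\bar A$ of variance $\sigma^2\le 1$ (with $\sigma>0$). Then for every $x>0$, $$\Pr\left[\rho_U(A)>1+x\right]<\frac{1}{\sqrt{2\pi}}\,\frac{n(n+1)}{x\,\sigma}.$$
   Context: $\|\cdot\|_2$ is the operator norm induced by the Euclidean norm; $\|\cdot\|_\infty$ of a matrix is the maximum absolute row sum. $A$ is a Gaussian perturbation of $\bar A$ of variance $\sigma^2$ if $A=\bar A+G$ where the entries of $G$ are independent Gaussian random variables with mean $0$ and standard deviation $\sigma$. With probability 1, $A$ has a unique LU-factorization (without pivoting) $A=LU$, where $L$ is lower-triangular with $1$s on the diagonal and $U$ is upper-triangular. The growth factor is $\rho_U(A)=\|U\|_\infty/\|A\|_\infty$. *)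

theory Defs
  imports "HOL-Analysis.Analysis" "HOL-Probability.Probability"
begin

text \<open>
  An $n \times n$ real matrix has type \<^typ>\<open>real ^ 'n ^ 'n\<close>, with \<open>A $ i $ j\<close> the entry in row \<open>i\<close>
  and column \<open>j\<close>. Triangularity needs an order on the indices, so \<open>'n\<close> is a finite well-order
  (every finite linear order is one), and $n$ is \<open>CARD('n)\<close>.
  The norm $\|A\|_2$ is \<open>onorm (matrix_vector_mult A)\<close>, since the norm of \<^typ>\<open>real ^ 'n\<close> is Euclidean.
\<close>

definition norm_inf :: "real ^ 'n ^ 'm \<Rightarrow> real" where
  "norm_inf A = Max (range (\<lambda>i. \<Sum>j\<in>UNIV. \<bar>A $ i $ j\<bar>))"

definition unit_lower_triangular :: "real ^ 'n::{finite,wellorder} ^ 'n::_ \<Rightarrow> bool" where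
  "unit_lower_triangular L \<longleftrightarrow> (\<forall>i j. i < j \<longrightarrow> L $ i $ j = 0) \<and> (\<forall>i. L $ i $ i = 1)"

definition upper_triangular :: "real ^ 'n::{finite,wellorder} ^ 'n::_ \<Rightarrow> bool" where
  "upper_triangular U \<longleftrightarrow> (\<forall>i j. j < i \<longrightarrow> U $ i $ j = 0)"

definition LU_factorization ::
    "real ^ 'n::{finite,wellorder} ^ 'n::_ \<Rightarrow> real ^ 'n::_ ^ 'n::_ \<Rightarrow> real ^ 'n::_ ^ 'n::_ \<Rightarrow> bool" where
  "LU_factorization A L U \<longleftrightarrow> unit_lower_triangular L \<and> upper_triangular U \<and> A = L ** U"

text \<open>
  The factor \<open>U\<close> of the unique LU-factorization of \<open>A\<close>. Where there is none, or more than one, the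
  value is fixed to be \<open>0\<close>, so that the function is Borel measurable; a Gaussian perturbation falls
  into this case with probability 0.
\<close>

definition LU_upper :: "real ^ 'n::{finite,wellorder} ^ 'n::_ \<Rightarrow> real ^ 'n::_ ^ 'n::_" where
  "LU_upper A =
     (if \<exists>!(L, U). LU_factorization A L U then (THE U. \<exists>L. LU_factorization A L U) else 0)"

definition growth_factor_U :: "real ^ 'n::{finite,wellorder} ^ 'n::_ \<Rightarrow> real" where
  "growth_factor_U A = norm_inf (LU_upper A) / norm_inf A"

text \<open>The parameter \<open>\<sigma>\<close> is the standard deviation, so the variance is \<open>\<sigma>\<^sup>2\<close>.\<close>

definition gaussian_perturbation ::
    "'a measure \<Rightarrow> real \<Rightarrow> real ^ 'n ^ 'm \<Rightarrow> ('a \<Rightarrow> real ^ 'n ^ 'm) \<Rightarrow> bool" where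
  "gaussian_perturbation M \<sigma> Abar A \<longleftrightarrow>
     (\<exists>G. (\<forall>\<omega>\<in>space M. A \<omega> = Abar + G \<omega>) \<and>
          prob_space.indep_vars M (\<lambda>_. borel) (\<lambda>(i, j) \<omega>. G \<omega> $ i $ j) UNIV \<and>
          (\<forall>i j. distributed M lborel (\<lambda>\<omega>. G \<omega> $ i $ j) (normal_density 0 \<sigma>)))"

end

theory Submission
  imports Defs
begin

text \<open>
  Eliminating the entries of row \<open>k\<close> of \<open>A\<close> to the left of the diagonal gives
  $U_k = A_k - w^T A$, where \<open>w\<close> is supported on \<open>{..<k}\<close> and solves $w^T C = b^T$; here \<open>C\<close> is the
  leading block with index set \<open>{..<k}\<close> and \<open>b\<close> consists of the first entries of row \<open>k\<close>. So
  $\|U_k\|_1 \le (1 + \|w\|_1) \|A\|_\infty$, and a growth factor above $1 + x$ forces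
  $\|w\|_2 \ge x / \sqrt d$ for some \<open>k\<close>, where \<open>d = card {..<k}\<close>.

  The block \<open>C\<close> and \<open>b\<close> are independent, so fix \<open>b\<close>. A reflection applied to all rows preserves the
  Gaussian law and turns \<open>b\<close> into $\|b\| e_j$. Then \<open>w\<close> is orthogonal to all columns of \<open>C\<close> but
  column \<open>j\<close>, hence a multiple of a unit vector \<open>t\<close> that depends on these other columns only, and
  $\|w\| = \|b\| / |t \cdot c_j|$, where $t \cdot c_j$ is Gaussian with standard deviation \<open>\<sigma>\<close>.
  Hence $\Pr[\|w\|_2 \ge y] \le \sqrt{2/\pi}\, E\|b\| / (y \sigma)$ with
  $E\|b\| \le \sqrt{1 + d}$. A union bound over \<open>k\<close> with $\sqrt{d (d + 1)} \le d + 1/2$ concludes.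

  Solvability with a unique solution replaces the almost sure existence of the factorization: where it
  is not unique, \<open>LU_upper\<close> is \<open>0\<close> and the growth factor is not large.
\<close>

section \<open>Large solutions of the elimination equations\<close>

text \<open>Invertibility of the \<open>I\<close> by \<open>I\<close> block, stated through its left
  kernel. Vectors of full length supported on \<open>I\<close> stand in for vectors indexed by the
  block, so no separate index type for the block appears.\<close>

definition block_nonsingular :: "'n set \<Rightarrow> real ^ 'n ^ 'n \<Rightarrow> bool" where
  "block_nonsingular I X \<longleftrightarrow>
     (\<forall>v. (\<forall>i. i \<notin> I \<longrightarrow> v $ i = 0) \<longrightarrow> (\<forall>j\<in>I. (v v* X) $ j = 0) \<longrightarrow> v = 0)"

text \<open>Nonsingularity makes the solution \<open>w\<close> unique, so its length can be computed
  from any other vector that satisfies the same equations.\<close>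

definition large_solution :: "'n set \<Rightarrow> real \<Rightarrow> real ^ 'n ^ 'n \<Rightarrow> real ^ 'n \<Rightarrow> bool" where
  "large_solution I y X b \<longleftrightarrow> block_nonsingular I X \<and>
     (\<exists>w. (\<forall>i. i \<notin> I \<longrightarrow> w $ i = 0) \<and> y \<le> norm w \<and> (\<forall>j\<in>I. (w v* X) $ j = b $ j))"

lemma vector_matrix_mult_rows: "v v* X = (\<Sum>i\<in>UNIV. v $ i *\<^sub>R X $ i)"
  for X :: "real ^ 'n ^ 'm"
  by (simp add: vec_eq_iff vector_matrix_mult_def mult.commute)

section \<open>Borel measurability of the event that the solution is large\<close>

lemma continuous_on_vector_matrix_mult [continuous_intros]:
  fixes f :: "'a::topological_space \<Rightarrow> real ^ 'm" and g :: "'a \<Rightarrow> real ^ 'n ^ 'm"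
  assumes "continuous_on S f" "continuous_on S g"
  shows "continuous_on S (\<lambda>x. f x v* g x)"
  unfolding vector_matrix_mult_def by (intro continuous_intros assms)

text \<open>The set is the projection, along the compact factor \<open>K\<close>, of a closed set of
  triples \<open>(w, X, b)\<close>.\<close>

lemma closed_solution_set:
  fixes I :: "'n::finite set"
  assumes "compact K"
  shows "closed {(X :: real ^ 'n ^ 'n, b :: real ^ 'n). \<exists>w\<in>K. \<forall>j\<in>I. (w v* X) $ j = b $ j}"
proof -
  let ?T = "{z :: (real ^ 'n) \<times> (real ^ 'n ^ 'n) \<times> (real ^ 'n).
              \<forall>j\<in>I. (fst z v* fst (snd z)) $ j = snd (snd z) $ j}"
  have "?T = (\<Inter>j\<in>I. {z. (fst z v* fst (snd z)) $ j = snd (snd z) $ j})"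
    by auto
  then have "closed ?T"
    by (auto intro!: closed_INT closed_Collect_eq continuous_intros)
  then have "closed {p. \<exists>w. w \<in> K \<and> (w, p) \<in> ?T}"
    by (rule closed_compact_projection[OF assms])
  also have "{p. \<exists>w. w \<in> K \<and> (w, p) \<in> ?T} = {(X, b). \<exists>w\<in>K. \<forall>j\<in>I. (w v* X) $ j = b $ j}"
    by (simp add: case_prod_unfold Bex_def)
  finally show ?thesis .
qed

lemma closed_supported: "closed {w :: real ^ 'n. \<forall>i. i \<notin> I \<longrightarrow> w $ i = 0}"
proof -
  have "{w :: real ^ 'n. \<forall>i. i \<notin> I \<longrightarrow> w $ i = 0} = (\<Inter>i\<in>-I. {w. w $ i = 0})"
    by auto
  then show ?thesis
    by (auto intro!: closed_INT closed_Collect_eq continuous_intros)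
qed

text \<open>Normalizing a kernel vector moves it to the compact unit sphere, which brings
  singularity into the form of \<open>closed_solution_set\<close> with right-hand side 0.\<close>

lemma block_singular_unit_kernel:
  "\<not> block_nonsingular I X \<longleftrightarrow>
     (\<exists>w\<in>{w. \<forall>i. i \<notin> I \<longrightarrow> w $ i = 0} \<inter> sphere 0 1. \<forall>j\<in>I. (w v* X) $ j = 0)"
proof
  assume "\<not> block_nonsingular I X"
  then obtain v where v: "\<forall>i. i \<notin> I \<longrightarrow> v $ i = 0" "\<forall>j\<in>I. (v v* X) $ j = 0" "v \<noteq> 0"
    by (auto simp: block_nonsingular_def)
  then have "\<forall>j\<in>I. ((v /\<^sub>R norm v) v* X) $ j = 0"
    by (simp add: vector_matrix_mult_def mult.assoc mult.left_commute flip: sum_distrib_left)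
  with v show "\<exists>w\<in>{w. \<forall>i. i \<notin> I \<longrightarrow> w $ i = 0} \<inter> sphere 0 1. \<forall>j\<in>I. (w v* X) $ j = 0"
    by (intro bexI[of _ "v /\<^sub>R norm v"]) auto
next
  assume "\<exists>w\<in>{w. \<forall>i. i \<notin> I \<longrightarrow> w $ i = 0} \<inter> sphere 0 1. \<forall>j\<in>I. (w v* X) $ j = 0"
  then obtain w where "\<forall>i. i \<notin> I \<longrightarrow> w $ i = 0" "norm w = 1" "\<forall>j\<in>I. (w v* X) $ j = 0"
    by auto
  then show "\<not> block_nonsingular I X"
    unfolding block_nonsingular_def by (metis norm_zero zero_neq_one)
qed

text \<open>The vectors of norm at least \<open>y\<close> are not a compact set, so they are
  exhausted by balls of integer radius. The event is then a countable union of closed sets minus the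
  closed set of singular blocks.\<close>

lemma sets_large_solution:
  fixes I :: "'n::finite set"
  shows "{(X, b). large_solution I y X b} \<in> sets (borel \<Otimes>\<^sub>M borel)"
proof -
  let ?V = "{w :: real ^ 'n. \<forall>i. i \<notin> I \<longrightarrow> w $ i = 0}"
  let ?K = "\<lambda>m::nat. ?V \<inter> {w. y \<le> norm w} \<inter> cball 0 (real m)"
  let ?S = "\<lambda>K. {(X :: real ^ 'n ^ 'n, b). \<exists>w\<in>K. \<forall>j\<in>I. (w v* X) $ j = b $ j}"
  have 1: "compact (?V \<inter> sphere 0 1)"
    by (intro closed_Int_compact closed_supported) simp
  have "compact (?K m)" for m
    by (intro closed_Int_compact closed_Int closed_supported closed_Collect_le continuous_intros) simp
  then have 2: "closed (?S (?K m))" for m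
    by (rule closed_solution_set)
  have "closed ((\<lambda>p. (fst p, 0)) -` ?S (?V \<inter> sphere 0 1) :: ((real ^ 'n ^ 'n) \<times> (real ^ 'n)) set)"
    by (intro closed_vimage closed_solution_set 1 continuous_intros)
  also have "(\<lambda>p. (fst p, 0)) -` ?S (?V \<inter> sphere 0 1) = {(X, b). \<not> block_nonsingular I X}"
    unfolding block_singular_unit_kernel by (simp add: case_prod_unfold vimage_def)
  finally have 3: "closed {(X :: real ^ 'n ^ 'n, b :: real ^ 'n). \<not> block_nonsingular I X}" .
  have eq: "{(X :: real ^ 'n ^ 'n, b). large_solution I y X b} =
        (\<Union>m. ?S (?K m)) - {(X, b). \<not> block_nonsingular I X}" (is "?A = ?B")
  proof (intro set_eqI iffI; clarsimp simp: large_solution_def)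
    fix w b :: "real ^ 'n" and X :: "real ^ 'n ^ 'n"
    assume "\<forall>i. i \<notin> I \<longrightarrow> w $ i = 0" "y \<le> norm w" "\<forall>j\<in>I. (w v* X) $ j = b $ j"
    then show "\<exists>m. \<exists>w\<in>?K m. \<forall>j\<in>I. (w v* X) $ j = b $ j"
      using real_arch_simple[of "norm w"] by fastforce
  qed blast
  have "?B \<in> sets borel"
    using 2 3 by (intro sets.Diff sets.countable_UN) (auto intro: borel_closed)
  then show ?thesis
    unfolding eq borel_prod .
qed

text \<open>Since \<open>v\<close> vanishes off \<open>I\<close>, the equations indexed by
  \<open>I\<close> only see the entries in the \<open>I\<close> by \<open>I\<close> block. This
  later allows replacing a matrix by its masked version.\<close>

lemma large_solution_cong:
  assumes "\<And>i j. i \<in> I \<Longrightarrow> j \<in> I \<Longrightarrow> X $ i $ j = X' $ i $ j" and "\<And>j. j \<in> I \<Longrightarrow> b $ j = b' $ j"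
  shows "large_solution I y X b \<longleftrightarrow> large_solution I y X' b'"
proof -
  have *: "(v v* X) $ j = (v v* X') $ j" if "\<forall>i. i \<notin> I \<longrightarrow> v $ i = 0" "j \<in> I" for v j
    unfolding vector_matrix_mult_def vec_lambda_beta
    by (rule sum.cong[OF refl]) (use that assms in auto)
  show ?thesis
    unfolding large_solution_def block_nonsingular_def using * assms(2) by auto
qed

section \<open>Reduction to a right-hand side along one basis vector\<close>

lemma householder_exists:
  fixes b :: "real ^ 'n"
  assumes "\<And>i. i \<notin> I \<Longrightarrow> b $ i = 0" and "j0 \<in> I"
  obtains f :: "real ^ 'n \<Rightarrow> real ^ 'n" where "orthogonal_transformation f"
    and "\<And>z. f (f z) = z" and "f b = axis j0 (norm b)"
    and "\<And>z j. \<forall>j\<in>I. z $ j = 0 \<Longrightarrow> j \<in> I \<Longrightarrow> f z $ j = 0"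
proof -
  define u where "u = b - axis j0 (norm b)"
  \<comment> \<open>The reflection in the hyperplane orthogonal to \<open>u\<close>. If
    \<open>u = 0\<close>, division by zero yields 0 and \<open>f\<close> is the identity, which is
    right because then \<open>b\<close> already lies along the axis.\<close>
  define f where "f z = z - (2 * (u \<bullet> z) / (u \<bullet> u)) *\<^sub>R u" for z
  have u0: "u $ i = 0" if "i \<notin> I" for i
    using that assms by (auto simp: u_def axis_def)
  have lin: "linear f"
    unfolding f_def by (intro linearI) (auto simp: algebra_simps inner_right_distrib add_divide_distrib)
  have inner_f: "f v \<bullet> f w = v \<bullet> w" for v w
    by (cases "u = 0") (auto simp: f_def inner_diff_left inner_diff_right inner_commute field_simps)
  have ff: "f (f z) = z" for z
    by (cases "u = 0") (auto simp: f_def inner_diff_right algebra_simps simp flip: scaleR_add_left)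
  \<comment> \<open>This holds because \<open>b\<close> and \<open>axis j0 (norm b)\<close> have the
    same length; it makes the reflection send \<open>b\<close> to \<open>b - u\<close>.\<close>
  have "2 * (u \<bullet> b) = u \<bullet> u"
    unfolding u_def
    by (simp add: inner_diff_left inner_diff_right inner_axis inner_axis' dot_square_norm[of b])
      (simp add: power2_eq_square axis_def algebra_simps)
  then have fb: "f b = axis j0 (norm b)"
    by (cases "u = 0") (auto simp: f_def u_def)
  have "f z $ j = 0" if "\<forall>j\<in>I. z $ j = 0" "j \<in> I" for z j
  proof -
    have "u $ i * z $ i = 0" for i
      using that u0 by (cases "i \<in> I") auto
    then have "u \<bullet> z = 0"
      unfolding inner_vec_def inner_real_def by (intro sum.neutral ballI)
    then show ?thesis
      using that by (simp add: f_def)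
  qed
  with that[of f] lin inner_f ff fb show thesis
    by (auto simp: orthogonal_transformation_def)
qed

text \<open>Acting on rows commutes with left multiplication by a vector, so the same
  \<open>w\<close> solves the rotated system. The last hypothesis says that agreement on
  \<open>I\<close> survives \<open>f\<close>; with \<open>f\<close> an involution it also works
  backwards, which preserves nonsingularity.\<close>

lemma large_solution_rotate:
  assumes "large_solution I y X b" and "linear f" and "\<And>z. f (f z) = z"
    and f0: "\<And>z j. \<forall>j\<in>I. z $ j = 0 \<Longrightarrow> j \<in> I \<Longrightarrow> f z $ j = 0"
  shows "large_solution I y (\<chi> i. f (X $ i)) (f b)"
proof -
  have *: "v v* (\<chi> i. f (X $ i)) = f (v v* X)" for v
    unfolding vector_matrix_mult_rows using \<open>linear f\<close> by (simp add: linear_sum linear_scale)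
  obtain w where w: "\<forall>i. i \<notin> I \<longrightarrow> w $ i = 0" "y \<le> norm w" "\<forall>j\<in>I. (w v* X) $ j = b $ j"
    and ns: "block_nonsingular I X"
    using assms(1) by (auto simp: large_solution_def)
  have "f (w v* X) $ j = f b $ j" if "j \<in> I" for j
  proof -
    have "f (w v* X) - f b = f (w v* X - b)"
      using \<open>linear f\<close> by (simp add: linear_diff)
    moreover have "f (w v* X - b) $ j = 0"
      by (rule f0) (use w that in auto)
    ultimately show ?thesis
      by (metis eq_iff_diff_eq_0 vector_minus_component)
  qed
  moreover have "block_nonsingular I (\<chi> i. f (X $ i))"
    unfolding block_nonsingular_def *
  proof (intro allI impI)
    fix v assume v: "\<forall>i. i \<notin> I \<longrightarrow> v $ i = 0" "\<forall>j\<in>I. f (v v* X) $ j = 0"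
    then have "\<forall>j\<in>I. f (f (v v* X)) $ j = 0"
      using f0[of "f (v v* X)"] by blast
    then show "v = 0"
      using ns v by (simp add: assms(3) block_nonsingular_def)
  qed
  ultimately show ?thesis
    using w by (auto simp: large_solution_def *)
qed

lemma unit_orthogonal_columns:
  fixes P :: "real ^ 'n ^ 'n"
  assumes "j0 \<in> I"
  obtains t where "norm t = 1" "\<And>i. i \<notin> I \<Longrightarrow> t $ i = 0"
    and "\<And>j. j \<in> I \<Longrightarrow> j \<noteq> j0 \<Longrightarrow> (t v* P) $ j = 0"
proof -
  \<comment> \<open>Column \<open>j0\<close> of \<open>B\<close> is zero, so \<open>B\<close> has a
    nonzero left kernel vector. The identity columns outside \<open>I\<close> force that vector to
    be supported on \<open>I\<close>, and the remaining columns give orthogonality to those of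
    \<open>P\<close>.\<close>
  define B :: "real ^ 'n ^ 'n" where
    "B = (\<chi> i j. if j \<in> I then (if i \<in> I \<and> j \<noteq> j0 then P $ i $ j else 0) else if i = j then 1 else 0)"
  have "column j0 B = 0"
    using assms by (simp add: B_def column_def vec_eq_iff)
  then have "B *v axis j0 1 = 0"
    by (simp add: matrix_vector_mult_basis)
  moreover have "axis j0 (1::real) \<noteq> 0"
    by (simp add: axis_eq_0_iff)
  ultimately have "\<not> (\<exists>C. C ** B = mat 1)"
    unfolding matrix_left_invertible_ker by blast
  then have "\<not> (\<exists>C. C ** transpose B = mat 1)"
    by (metis matrix_left_right_inverse matrix_transpose_mul transpose_mat transpose_transpose)
  then obtain w where "transpose B *v w = 0" and w: "w \<noteq> 0"
    unfolding matrix_left_invertible_ker by blast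
  then have wB: "(w v* B) $ j = 0" for j
    by simp
  have w0: "w $ j = 0" if "j \<notin> I" for j
    using wB[of j] that by (simp add: vector_matrix_mult_def B_def if_distrib[of "(*) _"] if_distrib[of "\<lambda>x. x * _"] cong: if_cong)
  have wP: "(w v* P) $ j = 0" if "j \<in> I" "j \<noteq> j0" for j
  proof -
    have "(w v* P) $ j = (w v* B) $ j"
      unfolding vector_matrix_mult_def vec_lambda_beta
      by (rule sum.cong[OF refl]) (use that w0 in \<open>auto simp: B_def\<close>)
    then show ?thesis
      by (simp add: wB)
  qed
  have "((w /\<^sub>R norm w) v* P) $ j = (w v* P) $ j / norm w" for j
    by (simp add: vector_matrix_mult_def sum_divide_distrib field_simps)
  with w w0 wP that[of "w /\<^sub>R norm w"] show thesis
    by auto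
qed

text \<open>With \<alpha> the product of \<open>t\<close> and column \<open>j0\<close>, both
  \<open>\<alpha> *\<^sub>R w\<close> and \<open>\<beta> *\<^sub>R t\<close> satisfy the equations
  with value \<alpha>\<beta> at \<open>j0\<close> and 0 elsewhere on \<open>I\<close>.
  Nonsingularity makes them equal, and comparing norms gives the bound.\<close>

lemma large_solution_column_bound:
  assumes "large_solution I y X (axis j0 \<beta>)" and "0 \<le> \<beta>" and "j0 \<in> I"
    and t: "norm t = 1" "\<And>i. i \<notin> I \<Longrightarrow> t $ i = 0"
      "\<And>j. j \<in> I \<Longrightarrow> j \<noteq> j0 \<Longrightarrow> (t v* X) $ j = 0"
  shows "\<bar>(t v* X) $ j0\<bar> * y \<le> \<beta>"
proof -
  obtain w where w: "\<forall>i. i \<notin> I \<longrightarrow> w $ i = 0" "y \<le> norm w" "\<forall>j\<in>I. (w v* X) $ j = axis j0 \<beta> $ j"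
    and ns: "block_nonsingular I X"
    using assms(1) by (auto simp: large_solution_def)
  define \<alpha> where "\<alpha> = (t v* X) $ j0"
  let ?v = "\<alpha> *\<^sub>R w - \<beta> *\<^sub>R t"
  have lin: "(?v v* X) $ j = \<alpha> * (w v* X) $ j - \<beta> * (t v* X) $ j" for j
    by (simp add: vector_matrix_mult_def sum_subtractf sum_distrib_left algebra_simps)
  have "?v = 0"
    using ns w t \<open>j0 \<in> I\<close> unfolding block_nonsingular_def
    by (elim allE[of _ ?v]) (auto simp only: lin, auto simp: \<alpha>_def axis_def)
  then have "norm (\<alpha> *\<^sub>R w) = norm (\<beta> *\<^sub>R t)"
    by simp
  then have "\<bar>\<alpha>\<bar> * norm w = \<beta>"
    using assms by simp
  moreover have "\<bar>\<alpha>\<bar> * y \<le> \<bar>\<alpha>\<bar> * norm w"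
    using w by (intro mult_left_mono) auto
  ultimately show ?thesis
    by (simp add: \<alpha>_def)
qed

section \<open>LU-factorization and row elimination\<close>

lemma norm_inf_ge: "(\<Sum>j\<in>UNIV. \<bar>A $ i $ j\<bar>) \<le> norm_inf A"
  unfolding norm_inf_def by (rule Max_ge) auto

lemma norm_inf_attained: "\<exists>i. norm_inf A = (\<Sum>j\<in>UNIV. \<bar>A $ i $ j\<bar>)"
proof -
  have "norm_inf A \<in> range (\<lambda>i. \<Sum>j\<in>UNIV. \<bar>A $ i $ j\<bar>)"
    unfolding norm_inf_def by (rule Max_in) auto
  then show ?thesis by auto
qed

lemma norm_inf_nonneg: "0 \<le> norm_inf A"
  using norm_inf_ge[of A undefined] by (meson abs_ge_zero order_trans sum_nonneg)

text \<open>If a diagonal entry \<open>U $ j $ j\<close> other than the last one is zero, adding a multiple of row \<open>j\<close>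
  of \<open>U\<close> to the next row keeps \<open>U\<close> upper triangular, which gives a second factorization.\<close>

lemma LU_unique_pivot_nonzero:
  fixes A :: "real ^ 'n::{finite,wellorder} ^ 'n::_"
  assumes LU: "LU_factorization A L U"
    and unique: "\<And>L' U'. LU_factorization A L' U' \<Longrightarrow> U' = U \<and> L' = L"
    and "j < k"
  shows "U $ j $ j \<noteq> 0"
proof
  assume Ujj: "U $ j $ j = 0"
  define m where "m = (LEAST m. j < m)"
  have jm: "j < m"
    unfolding m_def using \<open>j < k\<close> by (rule LeastI)
  have mle: "m \<le> i" if "j < i" for i
    unfolding m_def using that by (rule Least_le)
  define E :: "real ^ 'n::_ ^ 'n::_" where "E = (\<chi> r c. if r = m \<and> c = j then 1 else 0)"
  have LE: "(L ** E) $ r $ c = (if c = j then L $ r $ m else 0)" for r c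
    by (simp add: matrix_matrix_mult_def E_def if_distrib[of "(*) _"] if_bool_eq_conj cong: if_cong)
  have EU: "(E ** V) $ r $ c = (if r = m then V $ j $ c else 0)" for V :: "real ^ 'n::_ ^ 'n::_" and r c
    by (simp add: matrix_matrix_mult_def E_def if_distrib[of "\<lambda>x. x * _"] cong: if_cong)
  \<comment> \<open>Because \<open>j\<close> and \<open>m\<close> differ, \<open>E\<close> squares
    to zero. The identity plus \<open>E\<close> and the identity minus \<open>E\<close> are
    therefore inverse to each other and can be inserted between \<open>L\<close> and
    \<open>U\<close>.\<close>
  have "E ** (E ** U) = 0"
    using jm by (simp add: vec_eq_iff EU)
  moreover have "(L + L ** E) ** V = L ** V + L ** (E ** V)" for V :: "real ^ 'n::_ ^ 'n::_"
    unfolding matrix_mul_assoc by (simp add: vec_eq_iff matrix_matrix_mult_def[of "L + _"]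
        matrix_matrix_mult_def[of _ V] sum.distrib distrib_right)
  moreover have "B ** (V - W) = B ** V - B ** W" for B V W :: "real ^ 'n::_ ^ 'n::_"
    by (simp add: vec_eq_iff matrix_matrix_mult_def sum_subtractf right_diff_distrib)
  ultimately have "(L + L ** E) ** (U - E ** U) = L ** U"
    by simp
  moreover have "unit_lower_triangular (L + L ** E)"
    using LU jm unfolding LU_factorization_def unit_lower_triangular_def by (auto simp: LE)
  \<comment> \<open>Only row \<open>m\<close> changes, by row \<open>j\<close> of \<open>U\<close>.
    That row vanishes before column \<open>j\<close> by triangularity and at \<open>j\<close> by
    assumption; as \<open>m\<close> is the least index above \<open>j\<close>, it vanishes at every
    column before \<open>m\<close>.\<close>
  moreover have "upper_triangular (U - E ** U)"
    using LU jm mle Ujj unfolding LU_factorization_def upper_triangular_def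
    by (auto simp: EU) (metis antisym_conv3 leD)
  ultimately have "LU_factorization A (L + L ** E) (U - E ** U)"
    using LU by (simp add: LU_factorization_def)
  then have "L + L ** E = L"
    using unique by blast
  then have "(L ** E) $ m $ j = 0"
    by simp
  then show False
    using LU by (simp add: LE LU_factorization_def unit_lower_triangular_def)
qed

lemma unit_lower_triangular_vector_eq_0:
  fixes L :: "real ^ 'n::{finite,wellorder} ^ 'n::_"
  assumes "unit_lower_triangular L" and "v v* L = 0"
  shows "v = 0"
proof -
  have "det L = 1"
    using assms(1) by (simp add: det_lowerdiagonal unit_lower_triangular_def)
  then obtain B where "L ** B = mat 1"
    by (metis invertible_def invertible_det_nz zero_neq_one)
  then have "v = (v v* L) v* B"
    by (simp add: vector_matrix_mul_assoc)
  then show ?thesis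
    using assms(2) by simp
qed

text \<open>For \<open>v\<close> in the left kernel, \<open>z = v v* L\<close> satisfies a
  triangular system with matrix \<open>U\<close>. An index \<open>j < k\<close> is not the last one,
  so its pivot is nonzero and substitution in increasing order gives \<open>z = 0\<close>; then
  \<open>v = 0\<close> because \<open>L\<close> is invertible.\<close>

lemma LU_unique_block_nonsingular:
  fixes A :: "real ^ 'n::{finite,wellorder} ^ 'n::_"
  assumes LU: "LU_factorization A L U"
    and unique: "\<And>L' U'. LU_factorization A L' U' \<Longrightarrow> U' = U \<and> L' = L"
  shows "block_nonsingular {..<k} A"
  unfolding block_nonsingular_def
proof (intro allI impI)
  fix v :: "real ^ 'n::_"
  assume v0: "\<forall>i. i \<notin> {..<k} \<longrightarrow> v $ i = 0" and vA: "\<forall>j\<in>{..<k}. (v v* A) $ j = 0"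
  have L: "unit_lower_triangular L" and U: "upper_triangular U" and A: "A = L ** U"
    using LU by (auto simp: LU_factorization_def)
  define z where "z = v v* L"
  \<comment> \<open>Every nonzero entry of \<open>v\<close> sits at an index below \<open>k\<close>,
    where \<open>L\<close> has a zero in column \<open>j\<close>.\<close>
  have z_ge: "z $ j = 0" if "k \<le> j" for j
    unfolding z_def vector_matrix_mult_def vec_lambda_beta
    by (rule sum.neutral)
      (use that v0 L in \<open>metis lessThan_iff linorder_not_less mult_eq_0_iff not_less_iff_gr_or_eq order_less_le_trans unit_lower_triangular_def\<close>)
  have z_less: "j < k \<longrightarrow> z $ j = 0" for j
  proof (induction j rule: less_induct)
    case (less j)
    show ?case
    proof
      assume "j < k"
      have "(v v* A) $ j = (z v* U) $ j"
        by (simp add: A z_def vector_matrix_mul_assoc)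
      also have "\<dots> = (\<Sum>i\<in>UNIV. if i = j then U $ j $ j * z $ j else 0)"
        unfolding vector_matrix_mult_def vec_lambda_beta
        using less \<open>j < k\<close> U
        by (intro sum.cong) (auto simp: upper_triangular_def neq_iff intro: less_trans)
      finally have "U $ j $ j * z $ j = 0"
        using vA \<open>j < k\<close> by simp
      then show "z $ j = 0"
        using LU_unique_pivot_nonzero[OF LU unique \<open>j < k\<close>] by simp
    qed
  qed
  have "z = 0"
    using z_ge z_less by (metis linorder_not_less vec_eq_iff zero_index)
  then show "v = 0"
    unfolding z_def using L unit_lower_triangular_vector_eq_0 by blast
qed

lemma LU_row_elimination:
  fixes A :: "real ^ 'n::{finite,wellorder} ^ 'n::_"
  assumes LU: "LU_factorization A L U"
  shows "\<exists>w. (\<forall>i. k \<le> i \<longrightarrow> w $ i = 0) \<and> U $ k = A $ k - w v* A"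
proof (induction k rule: less_induct)
  case (less k)
  then obtain w where w0: "\<And>l i. l < k \<Longrightarrow> l \<le> i \<Longrightarrow> w l $ i = 0"
    and wU: "\<And>l. l < k \<Longrightarrow> U $ l = A $ l - w l v* A"
    by metis
  \<comment> \<open>By induction each earlier \<open>U $ l\<close> is \<open>axis l 1 - w l\<close>
    times \<open>A\<close>. Substituting this into row \<open>k\<close> of \<open>L ** U\<close> and
    solving for \<open>U $ k\<close> produces these coefficients.\<close>
  define w' where "w' = (\<Sum>l\<in>{..<k}. L $ k $ l *\<^sub>R (axis l 1 - w l))"
  have "A $ k = (\<Sum>l\<in>UNIV. L $ k $ l *\<^sub>R U $ l)"
    using LU by (simp add: LU_factorization_def vec_eq_iff matrix_matrix_mult_def)
  also have "\<dots> = (\<Sum>l\<in>insert k {..<k}. L $ k $ l *\<^sub>R U $ l)"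
    using LU by (intro sum.mono_neutral_right) (auto simp: LU_factorization_def unit_lower_triangular_def)
  also have "\<dots> = U $ k + (\<Sum>l\<in>{..<k}. L $ k $ l *\<^sub>R U $ l)"
    using LU by (simp add: LU_factorization_def unit_lower_triangular_def)
  also have "(\<Sum>l\<in>{..<k}. L $ k $ l *\<^sub>R U $ l) = (\<Sum>l\<in>{..<k}. L $ k $ l *\<^sub>R (axis l 1 - w l)) v* A"
  proof -
    have lin: "linear (\<lambda>v. v v* A)"
      by (simp add: matrix_vector_mul_linear flip: transpose_matrix_vector)
    have ax: "axis l 1 v* A = A $ l" for l
      by (simp add: vector_matrix_mult_rows axis_def if_distrib[of "\<lambda>c. c *\<^sub>R _"] cong: if_cong)
    show ?thesis
      unfolding linear_sum[OF lin] linear_scale[OF lin] linear_diff[OF lin] ax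
      using wU by (intro sum.cong) auto
  qed
  finally have "U $ k = A $ k - w' v* A"
    by (simp add: w'_def)
  moreover have "w' $ i = 0" if "k \<le> i" for i
    unfolding w'_def sum_component using that w0
    by (intro sum.neutral) (auto simp: axis_def)
  ultimately show ?case by blast
qed

lemma growth_factor_U_large_imp:
  fixes A :: "real ^ 'n::{finite,wellorder} ^ 'n::_"
  assumes growth: "growth_factor_U A > 1 + x" and "0 < x"
  obtains k where "{..<k} \<noteq> {}" and "large_solution {..<k} (x / sqrt (card {..<k})) A (A $ k)"
proof -
  have pos: "0 < norm_inf (LU_upper A)"
    and gr: "(1 + x) * norm_inf A < norm_inf (LU_upper A)"
  proof -
    \<comment> \<open>For norm 0 the quotient would be 0 by the convention on division,
      contradicting the assumed growth.\<close>
    have "norm_inf A > 0" 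
      using growth \<open>0 < x\<close> norm_inf_nonneg[of A] by (cases "norm_inf A = 0") (auto simp: growth_factor_U_def)
    then show gr: "(1 + x) * norm_inf A < norm_inf (LU_upper A)"
      using growth by (simp add: growth_factor_U_def pos_less_divide_eq)
    show "0 < norm_inf (LU_upper A)"
      using gr \<open>norm_inf A > 0\<close> \<open>0 < x\<close> by (smt (verit) mult_pos_pos)
  qed
  have "norm_inf (0 :: real ^ 'n::_ ^ 'n::_) = 0"
    using norm_inf_attained[of "0 :: real ^ 'n::_ ^ 'n::_"] by simp
  with pos have "\<exists>!(L, U). LU_factorization A L U"
    unfolding LU_upper_def by (auto split: if_splits)
  then obtain L U where LU: "LU_factorization A L U"
    and unique: "\<And>L' U'. LU_factorization A L' U' \<Longrightarrow> U' = U \<and> L' = L"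
    by (auto elim!: ex1E)
  have "(THE U. \<exists>L. LU_factorization A L U) = U"
    using LU unique by (intro the_equality) blast+
  then have "LU_upper A = U"
    unfolding LU_upper_def using \<open>\<exists>!(L, U). LU_factorization A L U\<close> by simp
  then obtain k where k: "norm_inf (LU_upper A) = (\<Sum>j\<in>UNIV. \<bar>U $ k $ j\<bar>)"
    using norm_inf_attained by metis
  obtain w where w0: "\<And>i. k \<le> i \<Longrightarrow> w $ i = 0" and wU: "U $ k = A $ k - w v* A"
    using LU_row_elimination[OF LU] by blast
  let ?s = "\<Sum>i\<in>UNIV. \<bar>w $ i\<bar>"
  have "norm_inf (LU_upper A) \<le> (\<Sum>j\<in>UNIV. \<bar>A $ k $ j\<bar> + (\<Sum>i\<in>UNIV. \<bar>w $ i\<bar> * \<bar>A $ i $ j\<bar>))"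
    unfolding k wU
  proof (rule sum_mono)
    fix j
    have "\<bar>(w v* A) $ j\<bar> \<le> (\<Sum>i\<in>UNIV. \<bar>w $ i\<bar> * \<bar>A $ i $ j\<bar>)"
      unfolding vector_matrix_mult_def vec_lambda_beta
      by (rule order_trans[OF sum_abs]) (simp add: abs_mult mult.commute)
    then show "\<bar>(A $ k - w v* A) $ j\<bar> \<le> \<bar>A $ k $ j\<bar> + (\<Sum>i\<in>UNIV. \<bar>w $ i\<bar> * \<bar>A $ i $ j\<bar>)"
      by simp
  qed
  also have "\<dots> = (\<Sum>j\<in>UNIV. \<bar>A $ k $ j\<bar>) + (\<Sum>i\<in>UNIV. \<bar>w $ i\<bar> * (\<Sum>j\<in>UNIV. \<bar>A $ i $ j\<bar>))"
    by (simp add: sum.distrib sum_distrib_left) (rule sum.swap)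
  also have "\<dots> \<le> norm_inf A + (\<Sum>i\<in>UNIV. \<bar>w $ i\<bar> * norm_inf A)"
    by (intro add_mono sum_mono mult_left_mono norm_inf_ge) auto
  also have "\<dots> = (1 + ?s) * norm_inf A"
    by (simp add: distrib_right flip: sum_distrib_right)
  finally have "x < ?s"
    using gr norm_inf_nonneg[of A] by (smt (verit) mult_right_mono)
  also have "?s = (\<Sum>i\<in>{..<k}. \<bar>w $ i\<bar> * 1)"
    using w0 by (intro sum.mono_neutral_cong_right) (auto simp: not_less)
  \<comment> \<open>Cauchy-Schwarz passes from the 1-norm of \<open>w\<close> to its Euclidean norm;
    the price is the square root of the size of its support set.\<close>
  also have "\<dots> \<le> L2_set (\<lambda>i. w $ i) {..<k} * L2_set (\<lambda>i. 1) {..<k}"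
    using L2_set_mult_ineq[of "\<lambda>i. w $ i" "\<lambda>i. 1" "{..<k}"] by simp
  also have "\<dots> \<le> norm w * sqrt (card {..<k})"
    unfolding norm_vec_def
    by (intro mult_mono) (auto simp: L2_set_def intro!: sum_nonneg sum_mono2 real_sqrt_le_mono)
  finally have *: "x < norm w * sqrt (card {..<k})" .
  then have "{..<k} \<noteq> {}"
    using \<open>0 < x\<close> by (intro notI) simp
  moreover from this have "x / sqrt (card {..<k}) \<le> norm w"
    using * by (simp add: pos_divide_le_eq card_gt_0_iff)
  \<comment> \<open>Triangularity of \<open>U\<close> turns the elimination identity into the linear
    system for \<open>w\<close>.\<close>
  moreover have "(w v* A) $ j = A $ k $ j" if "j < k" for j
  proof -
    have "U $ k $ j = 0"
      using LU that by (simp add: LU_factorization_def upper_triangular_def)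
    then show ?thesis
      using wU by simp
  qed
  moreover have "block_nonsingular {..<k} A"
    using LU_unique_block_nonsingular[OF LU unique] .
  moreover have "\<forall>i. i \<notin> {..<k} \<longrightarrow> w $ i = 0"
    using w0 by (simp add: not_less)
  ultimately show thesis
    by (intro that[of k]) (auto simp: large_solution_def)
qed

section \<open>Gaussian vectors and orthogonal transformations\<close>

lemma borel_measurable_orthogonal:
  fixes f :: "'a::euclidean_space \<Rightarrow> 'a"
  assumes "orthogonal_transformation f"
  shows "f \<in> borel_measurable borel"
  by (intro borel_measurable_continuous_onI linear_continuous_on)
    (metis assms linear_conv_bounded_linear orthogonal_transformation_linear)

text \<open>Boxes determine the measure. The preimage of a box is its image under the inverse map,
  which is again orthogonal and so preserves Lebesgue measure.\<close>

lemma distr_lborel_orthogonal: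
  fixes f :: "real ^ 'n::{finite,wellorder} \<Rightarrow> real ^ 'n::_"
  assumes f: "orthogonal_transformation f"
  shows "distr lborel borel f = lborel"
proof (rule lborel_eqI[symmetric])
  note borel_measurable_orthogonal[OF f, measurable]
  fix l u :: "real ^ 'n::_" assume lu: "\<And>b. b \<in> Basis \<Longrightarrow> l \<bullet> b \<le> u \<bullet> b"
  have inv: "orthogonal_transformation (inv f)"
    using f by (rule orthogonal_transformation_inv)
  have eq: "f -` box l u = inv f ` box l u"
    using bij_vimage_eq_inv_image[OF orthogonal_transformation_bij[OF f]] .
  have im: "inv f ` box l u \<in> lmeasurable"
    by (rule measurable_orthogonal_image[OF inv]) simp
  have "f -` box l u \<in> sets borel"
    using measurable_sets_borel[of f borel "box l u"] by simp
  then have "emeasure (distr lborel borel f) (box l u) = emeasure lebesgue (inv f ` box l u)"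
    by (simp add: emeasure_distr eq)
  also have "\<dots> = ennreal (measure lebesgue (inv f ` box l u))"
    by (rule emeasure_eq_measure2[OF im])
  also have "measure lebesgue (inv f ` box l u) = measure lebesgue (box l u)"
    by (rule measure_orthogonal_image[OF inv]) simp
  also have "\<dots> = (\<Prod>b\<in>Basis. (u - l) \<bullet> b)"
    using lu by (simp add: measure_completion measure_lborel_box)
  finally show "emeasure (distr lborel borel f) (box l u) = (\<Prod>b\<in>Basis. (u - l) \<bullet> b)" .
qed simp

text \<open>Tonelli for product functions, transported from the Euclidean basis to the index type
  along \<open>i \<mapsto> axis i 1\<close>.\<close>

lemma nn_integral_lborel_vec_prod:
  fixes f :: "'n::finite \<Rightarrow> real \<Rightarrow> ennreal"
  assumes [measurable]: "\<And>i. f i \<in> borel_measurable borel"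
  shows "(\<integral>\<^sup>+y. (\<Prod>i\<in>UNIV. f i (y $ i)) \<partial>(lborel :: (real ^ 'n) measure)) =
    (\<Prod>i\<in>UNIV. \<integral>\<^sup>+x. f i x \<partial>lborel)"
proof -
  let ?ax = "\<lambda>i. axis i 1 :: real ^ 'n"
  have Basis: "Basis = range ?ax"
    by (auto simp: Basis_vec_def)
  have inj: "inj ?ax"
    by (auto simp: inj_def axis_eq_axis)
  have "(\<integral>\<^sup>+y. (\<Prod>b\<in>Basis. f (inv ?ax b) (y \<bullet> b)) \<partial>lborel) =
      (\<Prod>b\<in>Basis. \<integral>\<^sup>+x. f (inv ?ax b) x \<partial>lborel)"
    by (rule nn_integral_lborel_prod) auto
  moreover have "inv ?ax (axis i 1) = i" for i
    using inv_f_f[OF inj] .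
  ultimately show ?thesis
    unfolding Basis by (simp add: prod.reindex inj inner_axis)
qed

text \<open>The law of a vector with independent centered Gaussian coordinates. Giving it by a
  density lets rotation invariance be read off from that density.\<close>

definition normal_vec :: "real \<Rightarrow> (real ^ 'n) measure" where
  "normal_vec \<sigma> = density lborel (\<lambda>y. \<Prod>i\<in>UNIV. ennreal (normal_density 0 \<sigma> (y $ i)))"

lemma sets_normal_vec [simp, measurable_cong]: "sets (normal_vec \<sigma>) = sets borel"
  by (simp add: normal_vec_def)

lemma borel_measurable_vec_component [measurable]: "(\<lambda>y :: 'b::euclidean_space ^ 'n. y $ i) \<in> borel_measurable borel"
  by (intro borel_measurable_continuous_onI continuous_intros)

lemma borel_measurable_vecI:
  fixes f :: "'a \<Rightarrow> 'b::euclidean_space ^ 'n"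
  assumes "\<And>i. (\<lambda>x. f x $ i) \<in> borel_measurable M"
  shows "f \<in> borel_measurable M"
proof (subst borel_measurable_euclidean_space, intro ballI)
  fix b :: "'b ^ 'n" assume "b \<in> Basis"
  then obtain i u where "b = axis i u"
    by (auto simp: Basis_vec_def)
  then show "(\<lambda>x. f x \<bullet> b) \<in> borel_measurable M"
    using assms by (simp add: inner_axis)
qed

lemma sets_vec_rectangle:
  assumes "\<And>i. A i \<in> sets borel"
  shows "{y :: real ^ 'n. \<forall>i. y $ i \<in> A i} \<in> sets borel"
proof -
  note assms [measurable]
  have "{y \<in> space borel. \<forall>i. (y :: real ^ 'n) $ i \<in> A i} \<in> sets borel"
    by measurable
  then show ?thesis by simp
qed

lemma emeasure_normal_vec_rectangle:
  assumes A: "\<And>i. A i \<in> sets borel"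
  shows "emeasure (normal_vec \<sigma>) {y :: real ^ 'n. \<forall>i. y $ i \<in> A i} =
    (\<Prod>i\<in>UNIV. emeasure (density lborel (normal_density 0 \<sigma>)) (A i))"
proof -
  note A [measurable]
  have "emeasure (normal_vec \<sigma>) {y :: real ^ 'n. \<forall>i. y $ i \<in> A i} =
      (\<integral>\<^sup>+y. (\<Prod>i\<in>UNIV. ennreal (normal_density 0 \<sigma> (y $ i))) * indicator {y. \<forall>i. y $ i \<in> A i} y \<partial>lborel)"
    unfolding normal_vec_def using sets_vec_rectangle[OF A]
    by (subst emeasure_density) auto
  also have "\<dots> = (\<integral>\<^sup>+y. (\<Prod>i\<in>UNIV. ennreal (normal_density 0 \<sigma> (y $ i)) * indicator (A i) (y $ i)) \<partial>lborel)"
  proof (rule nn_integral_cong)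
    fix y :: "real ^ 'n"
    have "indicator {y. \<forall>i. y $ i \<in> A i} y = (\<Prod>i\<in>UNIV. indicator (A i) (y $ i) :: ennreal)"
      by (auto simp: indicator_def prod_zero_iff)
    then show "(\<Prod>i\<in>UNIV. ennreal (normal_density 0 \<sigma> (y $ i))) * indicator {y. \<forall>i. y $ i \<in> A i} y =
        (\<Prod>i\<in>UNIV. ennreal (normal_density 0 \<sigma> (y $ i)) * indicator (A i) (y $ i))"
      by (simp add: prod.distrib)
  qed
  also have "\<dots> = (\<Prod>i\<in>UNIV. \<integral>\<^sup>+x. ennreal (normal_density 0 \<sigma> x) * indicator (A i) x \<partial>lborel)"
    by (rule nn_integral_lborel_vec_prod) simp
  also have "\<dots> = (\<Prod>i\<in>UNIV. emeasure (density lborel (normal_density 0 \<sigma>)) (A i))"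
    by (simp add: emeasure_density)
  finally show ?thesis .
qed

lemma prob_space_normal_vec:
  assumes "0 < \<sigma>" shows "prob_space (normal_vec \<sigma> :: (real ^ 'n) measure)"
proof
  interpret N: prob_space "density lborel (normal_density 0 \<sigma>)"
    using assms by (rule prob_space_normal_density)
  have "emeasure (normal_vec \<sigma>) {y :: real ^ 'n. \<forall>i. y $ i \<in> UNIV} = 1"
    using N.emeasure_space_1 by (subst emeasure_normal_vec_rectangle) auto
  then show "emeasure (normal_vec \<sigma>) (space (normal_vec \<sigma>) :: (real ^ 'n) set) = 1"
    by (simp add: normal_vec_def)
qed

text \<open>The product density depends on \<open>y\<close> through \<open>norm y\<close> only, and
  both the norm and Lebesgue measure are invariant under \<open>f\<close>.\<close>

lemma normal_vec_orthogonal: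
  fixes f :: "real ^ 'n::{finite,wellorder} \<Rightarrow> real ^ 'n::_"
  assumes f: "orthogonal_transformation f"
  shows "distr (normal_vec \<sigma>) borel f = normal_vec \<sigma>"
proof -
  note borel_measurable_orthogonal[OF f, measurable]
  define \<phi> :: "real ^ 'n::_ \<Rightarrow> ennreal" where "\<phi> y = (\<Prod>i\<in>UNIV. ennreal (normal_density 0 \<sigma> (y $ i)))" for y
  have [measurable]: "\<phi> \<in> borel_measurable borel"
    unfolding \<phi>_def by measurable
  have "\<phi> y = ennreal ((1 / sqrt (2 * pi * \<sigma>\<^sup>2)) ^ CARD('n) * exp (- (norm y)\<^sup>2 / (2 * \<sigma>\<^sup>2)))" for y
  proof -
    have "(\<Prod>i\<in>UNIV. exp (- (y $ i)\<^sup>2 / (2 * \<sigma>\<^sup>2))) = exp (- (norm y)\<^sup>2 / (2 * \<sigma>\<^sup>2))"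
      by (simp add: norm_vec_def L2_set_def sum_nonneg exp_sum [symmetric] sum_negf sum_divide_distrib)
    then show ?thesis
      by (simp add: \<phi>_def prod_ennreal normal_density_def prod.distrib power_divide prod_dividef)
  qed
  then have \<phi>f: "\<phi> (f y) = \<phi> y" for y
    using orthogonal_transformation_norm[OF f] by simp
  have "density lborel \<phi> = density (distr lborel borel f) \<phi>"
    using distr_lborel_orthogonal[OF f] by simp
  also have "\<dots> = distr (density lborel (\<lambda>y. \<phi> (f y))) borel f"
    by (rule density_distr) auto
  finally have "density lborel \<phi> = distr (density lborel \<phi>) borel f"
    unfolding \<phi>f .
  then show ?thesis
    unfolding normal_vec_def \<phi>_def by (rule sym)
qed

text \<open>Independence makes the two laws agree on rectangles. Boxes are rectangles and form an
  intersection-stable generator of the Borel sets.\<close>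

lemma (in prob_space) indep_normal_distr_vec:
  fixes Y :: "'a \<Rightarrow> real ^ 'n"
  assumes ind: "indep_vars (\<lambda>_. borel) (\<lambda>i \<omega>. Y \<omega> $ i) UNIV"
    and D: "\<And>i. distributed M lborel (\<lambda>\<omega>. Y \<omega> $ i) (normal_density 0 \<sigma>)" and "0 < \<sigma>"
  shows "Y \<in> borel_measurable M" and "distr M borel Y = normal_vec \<sigma>"
proof -
  have Y_i [measurable]: "(\<lambda>\<omega>. Y \<omega> $ i) \<in> borel_measurable M" for i
    using distributed_measurable[OF D] by simp
  show Y [measurable]: "Y \<in> borel_measurable M"
    by (rule borel_measurable_vecI) (rule Y_i)
  have rect: "emeasure (distr M borel Y) {y. \<forall>i. y $ i \<in> A i} = emeasure (normal_vec \<sigma>) {y. \<forall>i. y $ i \<in> A i}"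
    if A: "\<And>i. A i \<in> sets borel" for A
  proof -
    have "emeasure (distr M borel Y) {y. \<forall>i. y $ i \<in> A i} = emeasure M (\<Inter>i\<in>UNIV. (\<lambda>\<omega>. Y \<omega> $ i) -` A i \<inter> space M)"
      by (subst emeasure_distr) (auto intro!: sets_vec_rectangle A arg_cong[where f = "emeasure M"])
    also have "\<dots> = (\<Prod>i\<in>UNIV. ennreal (prob ((\<lambda>\<omega>. Y \<omega> $ i) -` A i \<inter> space M)))"
      using indep_varsD_finite[OF ind, of A] A by (simp add: emeasure_eq_measure prod_ennreal)
    also have "\<dots> = (\<Prod>i\<in>UNIV. emeasure (density lborel (normal_density 0 \<sigma>)) (A i))"
    proof (rule prod.cong[OF refl])
      fix i
      have "emeasure (density lborel (normal_density 0 \<sigma>)) (A i) = emeasure (distr M lborel (\<lambda>\<omega>. Y \<omega> $ i)) (A i)"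
        using distributed_distr_eq_density[OF D[of i]] by simp
      then show "ennreal (prob ((\<lambda>\<omega>. Y \<omega> $ i) -` A i \<inter> space M)) = emeasure (density lborel (normal_density 0 \<sigma>)) (A i)"
        using A by (simp add: emeasure_distr emeasure_eq_measure)
    qed
    finally show ?thesis
      by (simp add: emeasure_normal_vec_rectangle A)
  qed
  interpret N: prob_space "normal_vec \<sigma> :: (real ^ 'n) measure"
    using \<open>0 < \<sigma>\<close> by (rule prob_space_normal_vec)
  show "distr M borel Y = normal_vec \<sigma>"
  proof (rule measure_eqI_generator_eq)
    let ?E = "range (\<lambda>(a, b). box a b :: (real ^ 'n) set)"
    show "Int_stable ?E"
      by (auto simp: Int_stable_def box_Int_box)
    show "?E \<subseteq> Pow UNIV" "sets (distr M borel Y) = sigma_sets UNIV ?E" "sets (normal_vec \<sigma>) = sigma_sets UNIV ?E"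
      by (simp_all add: borel_eq_box)
    let ?A = "\<lambda>n::nat. box (- (real n *\<^sub>R One)) (real n *\<^sub>R One) :: (real ^ 'n) set"
    show "range ?A \<subseteq> ?E" "(\<Union>i. ?A i) = UNIV"
      unfolding UN_box_eq_UNIV by auto
    show "emeasure (distr M borel Y) (?A i) \<noteq> \<infinity>" for i
      by (subst emeasure_distr) auto
    show "emeasure (distr M borel Y) X = emeasure (normal_vec \<sigma>) X" if X: "X \<in> ?E" for X
    proof -
      obtain a b where "X = box a b"
        using X by auto
      then have "X = {y. \<forall>i. y $ i \<in> {a $ i<..<b $ i}}"
        by (auto simp: mem_box_cart)
      then show ?thesis
        using rect[of "\<lambda>i. {a $ i<..<b $ i}"] by simp
    qed
  qed
qed

lemma emeasure_normal_vec_component: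
  assumes "0 < \<sigma>" and "S \<in> sets borel"
  shows "emeasure (normal_vec \<sigma>) {y :: real ^ 'n. y $ k \<in> S} = emeasure (density lborel (normal_density 0 \<sigma>)) S"
proof -
  interpret N: prob_space "density lborel (normal_density 0 \<sigma>)"
    using assms by (intro prob_space_normal_density)
  let ?A = "\<lambda>i. if i = k then S else UNIV"
  have "emeasure (normal_vec \<sigma>) {y :: real ^ 'n. \<forall>i. y $ i \<in> ?A i} =
      (\<Prod>i\<in>UNIV. emeasure (density lborel (normal_density 0 \<sigma>)) (?A i))"
    using assms by (intro emeasure_normal_vec_rectangle) auto
  also have "\<dots> = (\<Prod>i\<in>UNIV. if i = k then emeasure (density lborel (normal_density 0 \<sigma>)) S else 1)"
    using N.emeasure_space_1 by (intro prod.cong) auto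
  also have "{y :: real ^ 'n. \<forall>i. y $ i \<in> ?A i} = {y. y $ k \<in> S}"
    by auto
  finally show ?thesis
    by simp
qed

section \<open>Gaussian matrices\<close>

abbreviation centered_gaussian :: "'a measure \<Rightarrow> real \<Rightarrow> ('a \<Rightarrow> real ^ 'n ^ 'm) \<Rightarrow> bool" where
  "centered_gaussian M \<sigma> G \<equiv>
     prob_space.indep_vars M (\<lambda>_. borel) (\<lambda>(i, j) \<omega>. G \<omega> $ i $ j) UNIV \<and>
     (\<forall>i j. distributed M lborel (\<lambda>\<omega>. G \<omega> $ i $ j) (normal_density 0 \<sigma>))"

context prob_space begin

text \<open>Grouping independent entries by the disjoint index sets \<open>{i} \<times> UNIV\<close>
  yields independent rows. Rows are the objects on which a rotation acts.\<close>

lemma centered_gaussian_rows: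
  fixes G :: "'a \<Rightarrow> real ^ 'n ^ 'm"
  assumes G: "centered_gaussian M \<sigma> G" and "0 < \<sigma>"
  shows "indep_vars (\<lambda>_. borel) (\<lambda>i \<omega>. G \<omega> $ i) UNIV" and "distr M borel (\<lambda>\<omega>. G \<omega> $ i) = normal_vec \<sigma>"
proof -
  have ind: "indep_vars (\<lambda>_. borel) (\<lambda>(i, j) \<omega>. G \<omega> $ i $ j) UNIV"
    using G by simp
  let ?Y = "\<lambda>i p. (\<chi> j. p (i, j)) :: real ^ 'n"
  have "indep_vars (\<lambda>i. PiM ({i} \<times> UNIV) (\<lambda>_. borel))
      (\<lambda>i \<omega>. restrict (\<lambda>p. (case p of (i, j) \<Rightarrow> \<lambda>\<omega>. G \<omega> $ i $ j) \<omega>) ({i} \<times> UNIV)) UNIV"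
    by (rule indep_vars_restrict[OF ind]) (auto simp: disjoint_family_on_def)
  then have "indep_vars (\<lambda>_. borel)
      (\<lambda>i. ?Y i \<circ> (\<lambda>\<omega>. restrict (\<lambda>p. (case p of (i, j) \<Rightarrow> \<lambda>\<omega>. G \<omega> $ i $ j) \<omega>) ({i} \<times> UNIV))) UNIV"
    by (rule indep_vars_compose) (auto intro!: borel_measurable_vecI)
  also have "(\<lambda>i. ?Y i \<circ> (\<lambda>\<omega>. restrict (\<lambda>p. (case p of (i, j) \<Rightarrow> \<lambda>\<omega>. G \<omega> $ i $ j) \<omega>) ({i} \<times> UNIV)))
      = (\<lambda>i \<omega>. G \<omega> $ i)"
    by (auto simp: fun_eq_iff vec_eq_iff)
  finally show "indep_vars (\<lambda>_. borel) (\<lambda>i \<omega>. G \<omega> $ i) UNIV" .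
  let ?Z = "\<lambda>j p. p (i, j) :: real"
  have "indep_vars (\<lambda>j. PiM {(i, j)} (\<lambda>_. borel))
      (\<lambda>j \<omega>. restrict (\<lambda>p. (case p of (i, j) \<Rightarrow> \<lambda>\<omega>. G \<omega> $ i $ j) \<omega>) {(i, j)}) UNIV"
    by (rule indep_vars_restrict[OF ind]) (auto simp: disjoint_family_on_def)
  then have "indep_vars (\<lambda>_. borel)
      (\<lambda>j. ?Z j \<circ> (\<lambda>\<omega>. restrict (\<lambda>p. (case p of (i, j) \<Rightarrow> \<lambda>\<omega>. G \<omega> $ i $ j) \<omega>) {(i, j)})) UNIV"
    by (rule indep_vars_compose) auto
  also have "(\<lambda>j. ?Z j \<circ> (\<lambda>\<omega>. restrict (\<lambda>p. (case p of (i, j) \<Rightarrow> \<lambda>\<omega>. G \<omega> $ i $ j) \<omega>) {(i, j)}))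
      = (\<lambda>j \<omega>. G \<omega> $ i $ j)"
    by (auto simp: fun_eq_iff)
  finally show "distr M borel (\<lambda>\<omega>. G \<omega> $ i) = normal_vec \<sigma>"
    using G \<open>0 < \<sigma>\<close> by (intro indep_normal_distr_vec) auto
qed

text \<open>The way back from rows to entries: a product event factors over the rows by
  independence, and within each row because \<open>normal_vec\<close> is a product law.\<close>

lemma centered_gaussianI_rows:
  fixes G :: "'a \<Rightarrow> real ^ 'n ^ 'm"
  assumes ind: "indep_vars (\<lambda>_. borel) (\<lambda>i \<omega>. G \<omega> $ i) UNIV"
    and D: "\<And>i. distr M borel (\<lambda>\<omega>. G \<omega> $ i) = normal_vec \<sigma>" and "0 < \<sigma>"
  shows "centered_gaussian M \<sigma> G"
proof
  have [measurable]: "(\<lambda>\<omega>. G \<omega> $ i) \<in> borel_measurable M" for i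
    using ind by (simp add: indep_vars_def)
  let ?N = "density lborel (normal_density 0 \<sigma>)"
  have row: "emeasure M ((\<lambda>\<omega>. G \<omega> $ i) -` S \<inter> space M) = emeasure (normal_vec \<sigma>) S"
    if "S \<in> sets borel" for S i
    using that by (simp flip: D[of i] add: emeasure_distr)
  have entry: "emeasure M ((\<lambda>\<omega>. G \<omega> $ i $ j) -` S \<inter> space M) = emeasure ?N S"
    if S [measurable]: "S \<in> sets borel" for S i j
  proof -
    have "{y \<in> space borel. (y :: real ^ 'n) $ j \<in> S} \<in> sets borel"
      by measurable
    then show ?thesis
      using row[of "{y. y $ j \<in> S}" i] emeasure_normal_vec_component[OF \<open>0 < \<sigma>\<close> S]
      by (simp add: vimage_def)
  qed
  show "indep_vars (\<lambda>_. borel) (\<lambda>(i, j) \<omega>. G \<omega> $ i $ j) UNIV"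
  proof (subst indep_vars_finite[where E = "\<lambda>_. sets borel"])
    show "\<forall>A\<in>UNIV \<rightarrow> sets borel.
        prob (\<Inter>p\<in>UNIV. (case p of (i, j) \<Rightarrow> \<lambda>\<omega>. G \<omega> $ i $ j) -` A p \<inter> space M) =
        (\<Prod>p\<in>UNIV. prob ((case p of (i, j) \<Rightarrow> \<lambda>\<omega>. G \<omega> $ i $ j) -` A p \<inter> space M))"
    proof
      fix A :: "'m \<times> 'n \<Rightarrow> real set" assume "A \<in> UNIV \<rightarrow> sets borel"
      then have A: "A p \<in> sets borel" for p by auto
      let ?R = "\<lambda>i. {y :: real ^ 'n. \<forall>j. y $ j \<in> A (i, j)}"
      have R: "?R i \<in> sets borel" for i
        by (rule sets_vec_rectangle) (rule A)
      have "(\<Inter>p\<in>UNIV. (case p of (i, j) \<Rightarrow> \<lambda>\<omega>. G \<omega> $ i $ j) -` A p \<inter> space M) =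
          (\<Inter>i\<in>UNIV. (\<lambda>\<omega>. G \<omega> $ i) -` ?R i \<inter> space M)"
        by auto
      then have "prob (\<Inter>p\<in>UNIV. (case p of (i, j) \<Rightarrow> \<lambda>\<omega>. G \<omega> $ i $ j) -` A p \<inter> space M) =
          (\<Prod>i\<in>UNIV. prob ((\<lambda>\<omega>. G \<omega> $ i) -` ?R i \<inter> space M))"
        using indep_varsD_finite[OF ind, of ?R] R by simp
      also have "\<dots> = (\<Prod>i\<in>UNIV. \<Prod>j\<in>UNIV. prob ((\<lambda>\<omega>. G \<omega> $ i $ j) -` A (i, j) \<inter> space M))"
      proof (rule prod.cong[OF refl])
        fix i
        have "ennreal (prob ((\<lambda>\<omega>. G \<omega> $ i) -` ?R i \<inter> space M)) = (\<Prod>j\<in>UNIV. emeasure ?N (A (i, j)))"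
          using row[OF R, of i] emeasure_normal_vec_rectangle[of "\<lambda>j. A (i, j)" \<sigma>] A
          by (simp add: emeasure_eq_measure)
        also have "\<dots> = (\<Prod>j\<in>UNIV. ennreal (prob ((\<lambda>\<omega>. G \<omega> $ i $ j) -` A (i, j) \<inter> space M)))"
          using entry[OF A] by (simp add: emeasure_eq_measure)
        finally show "prob ((\<lambda>\<omega>. G \<omega> $ i) -` ?R i \<inter> space M) =
            (\<Prod>j\<in>UNIV. prob ((\<lambda>\<omega>. G \<omega> $ i $ j) -` A (i, j) \<inter> space M))"
          by (simp add: prod_ennreal prod_nonneg)
      qed
      also have "\<dots> = (\<Prod>p\<in>UNIV. prob ((case p of (i, j) \<Rightarrow> \<lambda>\<omega>. G \<omega> $ i $ j) -` A p \<inter> space M))"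
        by (simp add: prod.cartesian_product case_prod_unfold)
      finally show "prob (\<Inter>p\<in>UNIV. (case p of (i, j) \<Rightarrow> \<lambda>\<omega>. G \<omega> $ i $ j) -` A p \<inter> space M) =
        (\<Prod>p\<in>UNIV. prob ((case p of (i, j) \<Rightarrow> \<lambda>\<omega>. G \<omega> $ i $ j) -` A p \<inter> space M))" .
    qed
  qed (auto simp: sets.sigma_sets_eq[of borel, simplified] sets.Int_stable[of borel])
  show "\<forall>i j. distributed M lborel (\<lambda>\<omega>. G \<omega> $ i $ j) (normal_density 0 \<sigma>)"
    using entry by (auto simp: distributed_def emeasure_distr intro!: measure_eqI)
qed

lemma centered_gaussian_rotate_rows:
  fixes G :: "'a \<Rightarrow> real ^ 'n::{finite,wellorder} ^ 'm" and f :: "real ^ 'n::_ \<Rightarrow> real ^ 'n::_"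
  assumes G: "centered_gaussian M \<sigma> G" and "0 < \<sigma>" and f: "orthogonal_transformation f"
  shows "centered_gaussian M \<sigma> (\<lambda>\<omega>. \<chi> i. f (G \<omega> $ i))"
proof (rule centered_gaussianI_rows)
  note rows = centered_gaussian_rows[OF G \<open>0 < \<sigma>\<close>]
  note f_meas [measurable] = borel_measurable_orthogonal[OF f]
  have [measurable]: "(\<lambda>\<omega>. G \<omega> $ i) \<in> borel_measurable M" for i
    using rows(1) by (simp add: indep_vars_def)
  show "indep_vars (\<lambda>_. borel) (\<lambda>i \<omega>. (\<chi> i. f (G \<omega> $ i)) $ i) UNIV"
    using indep_vars_compose[OF rows(1), of "\<lambda>_. f" "\<lambda>_. borel"] by (simp add: comp_def)
  show "distr M borel (\<lambda>\<omega>. (\<chi> i. f (G \<omega> $ i)) $ i) = normal_vec \<sigma>" for i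
    using normal_vec_orthogonal[OF f, of \<sigma>] distr_distr[of f borel borel "\<lambda>\<omega>. G \<omega> $ i" M]
    by (simp add: rows(2) comp_def)
qed fact

end

text \<open>Represents a subfamily of entries by a matrix of the same type, so that conditioning on
  some entries becomes conditioning on a random matrix.\<close>

definition mask :: "('m \<times> 'n) set \<Rightarrow> real ^ 'n ^ 'm \<Rightarrow> real ^ 'n ^ 'm" where
  "mask K X = (\<chi> i j. if (i, j) \<in> K then X $ i $ j else 0)"

section \<open>Conditioning on independent entries and small-ball estimates\<close>

context prob_space begin

lemma indep_var_mask:
  fixes G :: "'a \<Rightarrow> real ^ 'n ^ 'm"
  assumes G: "centered_gaussian M \<sigma> G" and "K \<inter> L = {}"
  shows "indep_var borel (\<lambda>\<omega>. mask K (G \<omega>)) borel (\<lambda>\<omega>. mask L (G \<omega>))"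
proof -
  let ?X = "\<lambda>(i, j) \<omega>. G \<omega> $ i $ j"
  let ?Y = "\<lambda>K p. (\<chi> i j. if (i, j) \<in> K then p (i, j) else 0) :: real ^ 'n ^ 'm"
  have Y: "?Y K \<in> measurable (PiM K (\<lambda>_. borel)) borel" for K
  proof (intro borel_measurable_vecI)
    fix i j show "(\<lambda>p. ?Y K p $ i $ j) \<in> measurable (PiM K (\<lambda>_. borel)) borel"
      by (cases "(i, j) \<in> K") (auto intro: measurable_component_singleton)
  qed
  have "indep_var (PiM K (\<lambda>_. borel)) (\<lambda>\<omega>. restrict (\<lambda>p. ?X p \<omega>) K)
      (PiM L (\<lambda>_. borel)) (\<lambda>\<omega>. restrict (\<lambda>p. ?X p \<omega>) L)"
    using assms by (intro indep_var_restrict) auto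
  from indep_var_compose[OF this Y Y] show ?thesis
    by (simp add: comp_def mask_def cong: if_cong)
qed

text \<open>By independence the joint law is a product, so Fubini permits freezing \<open>Y\<close>
  at a value \<open>c\<close>, bounding the probability over \<open>X\<close> alone, and averaging
  the bound.\<close>

lemma prob_indep_var_le:
  assumes XY: "indep_var S X T Y" and E: "E \<in> sets (S \<Otimes>\<^sub>M T)"
    and le: "\<And>c. c \<in> space T \<Longrightarrow> prob {\<omega> \<in> space M. (X \<omega>, c) \<in> E} \<le> g c"
    and int: "integrable M (\<lambda>\<omega>. g (Y \<omega>))"
  shows "prob {\<omega> \<in> space M. (X \<omega>, Y \<omega>) \<in> E} \<le> expectation (\<lambda>\<omega>. g (Y \<omega>))"
proof -
  have X [measurable]: "X \<in> measurable M S" and Y [measurable]: "Y \<in> measurable M T"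
    and eq: "distr M S X \<Otimes>\<^sub>M distr M T Y = distr M (S \<Otimes>\<^sub>M T) (\<lambda>\<omega>. (X \<omega>, Y \<omega>))"
    using XY unfolding indep_var_distribution_eq by auto
  note E [measurable]
  interpret X: prob_space "distr M S X" by (rule prob_space_distr) fact
  interpret Y: prob_space "distr M T Y" by (rule prob_space_distr) fact
  interpret P: pair_prob_space "distr M S X" "distr M T Y" ..
  have E': "E \<in> sets (distr M S X \<Otimes>\<^sub>M distr M T Y)"
    by (simp add: E cong: sets_pair_measure_cong)
  have "ennreal (prob {\<omega> \<in> space M. (X \<omega>, Y \<omega>) \<in> E}) = emeasure (distr M (S \<Otimes>\<^sub>M T) (\<lambda>\<omega>. (X \<omega>, Y \<omega>))) E"
    by (subst emeasure_distr) (auto simp: emeasure_eq_measure intro!: arg_cong[where f = prob])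
  also have "\<dots> = (\<integral>\<^sup>+c. emeasure (distr M S X) ((\<lambda>x. (x, c)) -` E) \<partial>distr M T Y)"
    unfolding eq[symmetric] by (rule P.emeasure_pair_measure_alt2[OF E'])
  also have "\<dots> = (\<integral>\<^sup>+\<omega>'. emeasure (distr M S X) ((\<lambda>x. (x, Y \<omega>')) -` E) \<partial>M)"
    using P.measurable_emeasure_Pair2[OF E'] by (intro nn_integral_distr) auto
  also have "\<dots> \<le> (\<integral>\<^sup>+\<omega>'. ennreal (g (Y \<omega>')) \<partial>M)"
  proof (rule nn_integral_mono)
    fix \<omega>' assume "\<omega>' \<in> space M"
    then have c: "Y \<omega>' \<in> space T"
      using Y by (rule measurable_space[rotated])
    have "emeasure (distr M S X) ((\<lambda>x. (x, Y \<omega>')) -` E) = emeasure M (X -` ((\<lambda>x. (x, Y \<omega>')) -` E) \<inter> space M)"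
      using E by (intro emeasure_distr X sets_Pair2)
    also have "X -` ((\<lambda>x. (x, Y \<omega>')) -` E) \<inter> space M = {\<omega> \<in> space M. (X \<omega>, Y \<omega>') \<in> E}"
      by auto
    finally show "emeasure (distr M S X) ((\<lambda>x. (x, Y \<omega>')) -` E) \<le> ennreal (g (Y \<omega>'))"
      using le[OF c] by (simp add: emeasure_eq_measure ennreal_leI)
  qed
  also have "\<dots> = ennreal (expectation (\<lambda>\<omega>. g (Y \<omega>)))"
  proof (rule nn_integral_eq_integral[OF int], rule AE_I2)
    fix \<omega> assume "\<omega> \<in> space M"
    then have "Y \<omega> \<in> space T"
      using Y by (rule measurable_space[rotated])
    then show "0 \<le> g (Y \<omega>)"
      using le measure_nonneg order_trans by blast
  qed
  finally have "ennreal (prob {\<omega> \<in> space M. (X \<omega>, Y \<omega>) \<in> E}) \<le> ennreal (expectation (\<lambda>\<omega>. g (Y \<omega>)))" .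
  moreover have "0 \<le> expectation (\<lambda>\<omega>. g (Y \<omega>))"
    using le measurable_space[OF Y] by (intro integral_nonneg_AE AE_I2) (meson measure_nonneg order_trans)
  ultimately show ?thesis
    by simp
qed

text \<open>The density never exceeds its peak value and the interval has length 2\<epsilon>. The
  bound is uniform in the mean \<mu>, which later absorbs every deterministic shift.\<close>

lemma normal_small_ball:
  assumes D: "distributed M lborel X (normal_density \<mu> \<sigma>)" and "0 < \<sigma>" and "0 \<le> \<epsilon>"
  shows "prob {\<omega> \<in> space M. \<bar>X \<omega>\<bar> \<le> \<epsilon>} \<le> 2 * \<epsilon> / (sqrt (2 * pi) * \<sigma>)"
proof -
  have "ennreal (prob {\<omega> \<in> space M. \<bar>X \<omega>\<bar> \<le> \<epsilon>}) = emeasure M (X -` {-\<epsilon>..\<epsilon>} \<inter> space M)"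
    by (auto simp: emeasure_eq_measure abs_le_iff intro!: arg_cong[where f = prob])
  also have "\<dots> = (\<integral>\<^sup>+x. ennreal (normal_density \<mu> \<sigma> x) * indicator {-\<epsilon>..\<epsilon>} x \<partial>lborel)"
    by (rule distributed_emeasure[OF D]) simp
  also have "\<dots> \<le> (\<integral>\<^sup>+x. ennreal (1 / (sqrt (2 * pi) * \<sigma>)) * indicator {-\<epsilon>..\<epsilon>} x \<partial>lborel)"
  proof (intro nn_integral_mono mult_right_mono ennreal_leI)
    fix x
    have "normal_density \<mu> \<sigma> x \<le> 1 / sqrt (2 * pi * \<sigma>\<^sup>2) * 1"
      unfolding normal_density_def by (intro mult_left_mono) auto
    then show "normal_density \<mu> \<sigma> x \<le> 1 / (sqrt (2 * pi) * \<sigma>)"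
      using \<open>0 < \<sigma>\<close> by (simp add: real_sqrt_mult)
  qed simp
  also have "\<dots> = ennreal (2 * \<epsilon> / (sqrt (2 * pi) * \<sigma>))"
    using assms by (subst nn_integral_cmult_indicator) (auto simp flip: ennreal_mult)
  finally show ?thesis
    using assms by simp
qed

text \<open>A combination of independent Gaussians whose coefficient vector has unit length again
  has standard deviation \<sigma>; \<open>B\<close> only moves the mean.\<close>

lemma centered_gaussian_column_small_ball:
  fixes G :: "'a \<Rightarrow> real ^ 'n ^ 'm"
  assumes G: "centered_gaussian M \<sigma> G" and "0 < \<sigma>" and "0 \<le> \<epsilon>" and t: "norm t = 1"
  shows "prob {\<omega> \<in> space M. \<bar>(t v* (B + G \<omega>)) $ j\<bar> \<le> \<epsilon>} \<le> 2 * \<epsilon> / (sqrt (2 * pi) * \<sigma>)"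
proof -
  \<comment> \<open>Zero coefficients are left out because scaling by 0 does not produce a normal
    density.\<close>
  define J where "J = (\<lambda>i. (i, j)) ` {i. t $ i \<noteq> 0}"
  define X where "X p \<omega> = t $ fst p * B $ fst p $ snd p + t $ fst p * G \<omega> $ fst p $ snd p" for p \<omega>
  have inj: "inj_on (\<lambda>i. (i, j)) S" for S :: "'m set"
    by (auto simp: inj_on_def)
  have "t \<noteq> 0"
    using t by auto
  then have J: "finite J" "J \<noteq> {}"
    by (auto simp: J_def vec_eq_iff)
  have "indep_vars (\<lambda>_. borel)
      (\<lambda>p. (\<lambda>z. t $ fst p * B $ fst p $ snd p + t $ fst p * z) \<circ> (\<lambda>(i, j) \<omega>. G \<omega> $ i $ j) p) J"
    using G by (intro indep_vars_compose[where M' = "\<lambda>_. borel"] indep_vars_subset[where J = J and I = UNIV]) auto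
  then have ind: "indep_vars (\<lambda>_. borel) X J"
    by (simp add: X_def[abs_def] comp_def case_prod_unfold)
  have D: "distributed M lborel (X p)
      (normal_density (t $ fst p * B $ fst p $ snd p + t $ fst p * 0) (\<bar>t $ fst p\<bar> * \<sigma>))" if "p \<in> J" for p
    unfolding X_def[abs_def] using G that \<open>0 < \<sigma>\<close> by (intro normal_density_affine) (auto simp: J_def)
  have "(\<Sum>p\<in>J. (\<bar>t $ fst p\<bar> * \<sigma>)\<^sup>2) = (\<Sum>i\<in>UNIV. (t $ i)\<^sup>2) * \<sigma>\<^sup>2"
    unfolding J_def sum.reindex[OF inj] sum_distrib_right
    by (rule sum.mono_neutral_cong_left) (auto simp: power_mult_distrib)
  also have "(\<Sum>i\<in>UNIV. (t $ i)\<^sup>2) = (norm t)\<^sup>2"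
    by (simp add: norm_vec_def L2_set_def sum_nonneg)
  finally have sd: "sqrt (\<Sum>p\<in>J. (\<bar>t $ fst p\<bar> * \<sigma>)\<^sup>2) = \<sigma>"
    using t \<open>0 < \<sigma>\<close> by simp
  have "(\<Sum>p\<in>J. X p \<omega>) = (t v* (B + G \<omega>)) $ j" for \<omega>
    unfolding J_def sum.reindex[OF inj] vector_matrix_mult_def vec_lambda_beta
    by (rule sum.mono_neutral_cong_left) (auto simp: X_def algebra_simps)
  then have "\<exists>\<mu>. distributed M lborel (\<lambda>\<omega>. (t v* (B + G \<omega>)) $ j) (normal_density \<mu> \<sigma>)"
    using sum_indep_normal[OF J ind _ D] \<open>0 < \<sigma>\<close> unfolding sd by (force simp: J_def)
  then show ?thesis
    using normal_small_ball \<open>0 < \<sigma>\<close> \<open>0 \<le> \<epsilon>\<close> by blast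
qed

end

section \<open>Tail bounds\<close>

context prob_space begin

lemma centered_gaussian_measurable:
  fixes G :: "'a \<Rightarrow> real ^ 'n ^ 'm"
  assumes G: "centered_gaussian M \<sigma> G"
  shows "G \<in> borel_measurable M"
proof (intro borel_measurable_vecI)
  fix i j show "(\<lambda>\<omega>. G \<omega> $ i $ j) \<in> borel_measurable M"
    using G distributed_measurable by fastforce
qed

lemma sets_large_solution_vimage:
  fixes F :: "'b \<Rightarrow> real ^ 'n ^ 'n"
  assumes "F \<in> borel_measurable N" "h \<in> borel_measurable N"
  shows "{z \<in> space N. large_solution I y (F z) (h z)} \<in> sets N"
proof -
  note sets_large_solution[of I y, measurable]
  note assms [measurable]
  have "{z \<in> space N. (F z, h z) \<in> {(X, b). large_solution I y X b}} \<in> sets N"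
    by measurable
  then show ?thesis by simp
qed

lemma borel_measurable_mask [measurable]: "mask K \<in> borel_measurable borel"
  unfolding mask_def by (intro borel_measurable_vecI) (simp, measurable)

text \<open>All columns except \<open>j0\<close> are frozen. They determine the unit vector
  \<open>t\<close>, and a large solution forces the product of \<open>t\<close> with the random
  column \<open>j0\<close> into an interval of radius \<beta>/y around 0.\<close>

lemma prob_large_solution_axis:
  fixes G :: "'a \<Rightarrow> real ^ 'n ^ 'n"
  assumes G: "centered_gaussian M \<sigma> G" and "0 < \<sigma>" and "0 \<le> \<beta>" and "0 < y" and "j0 \<in> I"
  shows "prob {\<omega> \<in> space M. large_solution I y (B + G \<omega>) (axis j0 \<beta>)} \<le> 2 * (\<beta> / y) / (sqrt (2 * pi) * \<sigma>)"
proof -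
  note [measurable] = centered_gaussian_measurable[OF G]
  define K :: "('n \<times> 'n) set" where "K = UNIV \<times> {j0}"
  let ?E = "{p \<in> space (borel \<Otimes>\<^sub>M borel). large_solution I y (B + fst p + snd p) (axis j0 \<beta>)}"
  have split: "B + mask K X + mask (- K) X = B + X" for X
    by (simp add: vec_eq_iff mask_def)
  have "prob {\<omega> \<in> space M. (mask K (G \<omega>), mask (- K) (G \<omega>)) \<in> ?E} \<le>
      expectation (\<lambda>\<omega>. (\<lambda>_. 2 * (\<beta> / y) / (sqrt (2 * pi) * \<sigma>)) (mask (- K) (G \<omega>)))"
  proof (rule prob_indep_var_le)
    show "indep_var borel (\<lambda>\<omega>. mask K (G \<omega>)) borel (\<lambda>\<omega>. mask (- K) (G \<omega>))"
      by (rule indep_var_mask[OF G]) auto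
    show "?E \<in> sets (borel \<Otimes>\<^sub>M borel)"
      by (rule sets_large_solution_vimage) measurable
    fix c :: "real ^ 'n ^ 'n"
    obtain t where t: "norm t = 1" "\<And>i. i \<notin> I \<Longrightarrow> t $ i = 0"
        "\<And>j. j \<in> I \<Longrightarrow> j \<noteq> j0 \<Longrightarrow> (t v* (B + c)) $ j = 0"
      using unit_orthogonal_columns[OF \<open>j0 \<in> I\<close>] by metis
    have off: "(t v* (B + mask K X + c)) $ j = (t v* (B + c)) $ j" if "j \<noteq> j0" for X j
      using that by (simp add: vector_matrix_mult_def mask_def K_def)
    have on: "(t v* (B + mask K X + c)) $ j0 = (t v* ((B + c) + X)) $ j0" for X
      by (simp add: vector_matrix_mult_def mask_def K_def add_ac)
    have "prob {\<omega> \<in> space M. (mask K (G \<omega>), c) \<in> ?E} \<le>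
        prob {\<omega> \<in> space M. \<bar>(t v* ((B + c) + G \<omega>)) $ j0\<bar> \<le> \<beta> / y}"
    proof (rule finite_measure_mono)
      show "{\<omega> \<in> space M. (mask K (G \<omega>), c) \<in> ?E} \<subseteq> {\<omega> \<in> space M. \<bar>(t v* ((B + c) + G \<omega>)) $ j0\<bar> \<le> \<beta> / y}"
      proof
        fix \<omega> assume \<omega>: "\<omega> \<in> {\<omega> \<in> space M. (mask K (G \<omega>), c) \<in> ?E}"
        then have "large_solution I y (B + mask K (G \<omega>) + c) (axis j0 \<beta>)"
          by simp
        then have "\<bar>(t v* (B + mask K (G \<omega>) + c)) $ j0\<bar> * y \<le> \<beta>"
          by (rule large_solution_column_bound) (use t off assms in auto)
        then show "\<omega> \<in> {\<omega> \<in> space M. \<bar>(t v* ((B + c) + G \<omega>)) $ j0\<bar> \<le> \<beta> / y}"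
          using \<omega> \<open>0 < y\<close> by (simp add: on pos_le_divide_eq)
      qed
      have [measurable]: "(\<lambda>X :: real ^ 'n ^ 'n. (t v* ((B + c) + X)) $ j0) \<in> borel_measurable borel"
        by (intro borel_measurable_continuous_onI continuous_intros)
      show "{\<omega> \<in> space M. \<bar>(t v* ((B + c) + G \<omega>)) $ j0\<bar> \<le> \<beta> / y} \<in> events"
        by measurable
    qed
    also have "\<dots> \<le> 2 * (\<beta> / y) / (sqrt (2 * pi) * \<sigma>)"
      by (rule centered_gaussian_column_small_ball[OF G]) (use assms t in auto)
    finally show "prob {\<omega> \<in> space M. (mask K (G \<omega>), c) \<in> ?E} \<le> 2 * (\<beta> / y) / (sqrt (2 * pi) * \<sigma>)" .
  qed simp
  then show ?thesis
    by (simp add: split space_pair_measure prob_space)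
qed

text \<open>The reflection that sends \<open>b\<close> to an axis preserves the law of the noise. It
  also changes the mean matrix \<open>B\<close>, but the estimate for an axis is uniform in that
  matrix.\<close>

lemma prob_large_solution_fixed:
  fixes G :: "'a \<Rightarrow> real ^ 'n::{finite,wellorder} ^ 'n::_"
  assumes G: "centered_gaussian M \<sigma> G" and "0 < \<sigma>" and "0 < y" and "I \<noteq> {}"
    and b0: "\<And>i. i \<notin> I \<Longrightarrow> b $ i = 0"
  shows "prob {\<omega> \<in> space M. large_solution I y (B + G \<omega>) b} \<le> 2 * (norm b / y) / (sqrt (2 * pi) * \<sigma>)"
proof -
  obtain j0 where "j0 \<in> I"
    using \<open>I \<noteq> {}\<close> by auto
  obtain f :: "real ^ 'n::_ \<Rightarrow> real ^ 'n::_" where f: "orthogonal_transformation f" and ff: "\<And>z. f (f z) = z"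
    and fb: "f b = axis j0 (norm b)" and f0: "\<And>z j. \<forall>j\<in>I. z $ j = 0 \<Longrightarrow> j \<in> I \<Longrightarrow> f z $ j = 0"
    using householder_exists[OF b0 \<open>j0 \<in> I\<close>] by metis
  have lin: "linear f"
    using f by (rule orthogonal_transformation_linear)
  let ?f = "\<lambda>X :: real ^ 'n::_ ^ 'n::_. \<chi> i. f (X $ i)"
  have G': "centered_gaussian M \<sigma> (\<lambda>\<omega>. ?f (G \<omega>))"
    using centered_gaussian_rotate_rows[OF G \<open>0 < \<sigma>\<close> f] .
  have "prob {\<omega> \<in> space M. large_solution I y (B + G \<omega>) b} \<le>
      prob {\<omega> \<in> space M. large_solution I y (?f B + ?f (G \<omega>)) (axis j0 (norm b))}"
  proof (rule finite_measure_mono)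
    have "large_solution I y (?f B + ?f X) (axis j0 (norm b))" if "large_solution I y (B + X) b" for X
    proof -
      have "?f (B + X) = ?f B + ?f X"
        by (simp add: vec_eq_iff linear_add[OF lin])
      then show ?thesis
        using large_solution_rotate[OF that lin ff f0] fb by simp
    qed
    then show "{\<omega> \<in> space M. large_solution I y (B + G \<omega>) b} \<subseteq>
      {\<omega> \<in> space M. large_solution I y (?f B + ?f (G \<omega>)) (axis j0 (norm b))}"
      by blast
    show "{\<omega> \<in> space M. large_solution I y (?f B + ?f (G \<omega>)) (axis j0 (norm b))} \<in> events"
      using centered_gaussian_measurable[OF G'] by (intro sets_large_solution_vimage) auto
  qed
  also have "\<dots> \<le> 2 * (norm b / y) / (sqrt (2 * pi) * \<sigma>)"
    by (rule prob_large_solution_axis[OF G']) (use assms \<open>j0 \<in> I\<close> in auto)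
  finally show ?thesis .
qed

lemma prob_large_solution_row:
  fixes G :: "'a \<Rightarrow> real ^ 'n::{finite,wellorder} ^ 'n::_"
  assumes G: "centered_gaussian M \<sigma> G" and "0 < \<sigma>" and "0 < y" and "I \<noteq> {}" and "k \<notin> I"
  shows "prob {\<omega> \<in> space M. large_solution I y (B + G \<omega>) ((B + G \<omega>) $ k)} \<le>
      2 * sqrt ((norm (B $ k))\<^sup>2 + real (card I) * \<sigma>\<^sup>2) / (y * (sqrt (2 * pi) * \<sigma>))"
proof -
  note [measurable] = centered_gaussian_measurable[OF G]
  define K :: "('n \<times> 'n) set" where "K = I \<times> I"
  define L :: "('n \<times> 'n) set" where "L = {k} \<times> I"
  \<comment> \<open>Row \<open>k\<close> is cut off outside \<open>I\<close> to meet the support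
    condition of \<open>prob_large_solution_fixed\<close>; the entries on \<open>I\<close> are
    independent of the block since \<open>k\<close> is not in \<open>I\<close>.\<close>
  define h :: "real ^ 'n::_ ^ 'n::_ \<Rightarrow> real ^ 'n::_" where "h X = (\<chi> j. if j \<in> I then (B + X) $ k $ j else 0)" for X
  define C where "C = 2 / (y * (sqrt (2 * pi) * \<sigma>))"
  have C: "0 < C"
    using assms by (simp add: C_def)
  have [measurable]: "h \<in> borel_measurable borel"
    unfolding h_def by (intro borel_measurable_vecI) (simp, measurable)
  have hL: "h (mask L X) = h X" for X
    by (simp add: vec_eq_iff h_def mask_def L_def)
  let ?E = "{p \<in> space (borel \<Otimes>\<^sub>M borel). large_solution I y (B + fst p) (h (snd p))}"
  have norm_h: "(norm (h X))\<^sup>2 = (\<Sum>j\<in>I. (B $ k $ j + X $ k $ j)\<^sup>2)" for X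
  proof -
    have "(norm (h X))\<^sup>2 = (\<Sum>j\<in>UNIV. (h X $ j)\<^sup>2)"
      by (simp add: norm_vec_def L2_set_def sum_nonneg)
    also have "\<dots> = (\<Sum>j\<in>I. (B $ k $ j + X $ k $ j)\<^sup>2)"
      by (rule sum.mono_neutral_cong_right) (auto simp: h_def)
    finally show ?thesis .
  qed
  have sq: "has_bochner_integral M (\<lambda>\<omega>. (B $ k $ j + G \<omega> $ k $ j)\<^sup>2) ((B $ k $ j)\<^sup>2 + \<sigma>\<^sup>2)" for j
  proof -
    have D: "distributed M lborel (\<lambda>\<omega>. G \<omega> $ k $ j) (normal_density 0 \<sigma>)"
      using G by simp
    have i1: "integrable M (\<lambda>\<omega>. G \<omega> $ k $ j)"
      using distributed_integrable[OF D, of "\<lambda>x. x"] integrable_normal_moment_nz_1[OF \<open>0 < \<sigma>\<close>, of 0] by simp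
    have i2: "integrable M (\<lambda>\<omega>. (G \<omega> $ k $ j)\<^sup>2)"
      using distributed_integrable[OF D, of "\<lambda>x. x\<^sup>2"] integrable_normal_moment[OF \<open>0 < \<sigma>\<close>, of 0 2] by simp
    have e1: "expectation (\<lambda>\<omega>. G \<omega> $ k $ j) = 0"
      by (rule normal_distributed_expectation[OF \<open>0 < \<sigma>\<close> D])
    have e2: "expectation (\<lambda>\<omega>. (G \<omega> $ k $ j)\<^sup>2) = \<sigma>\<^sup>2"
      using normal_distributed_variance[OF \<open>0 < \<sigma>\<close> D] by (simp add: e1)
    show ?thesis
      unfolding has_bochner_integral_iff power2_sum using i1 i2 by (simp add: e1 e2 prob_space)
  qed
  have hsq: "has_bochner_integral M (\<lambda>\<omega>. (norm (h (G \<omega>)))\<^sup>2) (\<Sum>j\<in>I. (B $ k $ j)\<^sup>2 + \<sigma>\<^sup>2)"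
    unfolding norm_h by (rule has_bochner_integral_sum) (rule sq)
  have int_h: "integrable M (\<lambda>\<omega>. norm (h (G \<omega>)))"
    by (rule square_integrable_imp_integrable) (use hsq in \<open>auto simp: has_bochner_integral_iff\<close>)
  \<comment> \<open>Nonnegativity of the variance bounds the mean length by the root mean square,
    which is explicit.\<close>
  have "(expectation (\<lambda>\<omega>. norm (h (G \<omega>))))\<^sup>2 \<le> expectation (\<lambda>\<omega>. (norm (h (G \<omega>)))\<^sup>2)"
  proof -
    have "variance (\<lambda>\<omega>. norm (h (G \<omega>))) =
        expectation (\<lambda>\<omega>. (norm (h (G \<omega>)))\<^sup>2) - (expectation (\<lambda>\<omega>. norm (h (G \<omega>))))\<^sup>2"
      using hsq by (intro variance_eq int_h) (simp add: has_bochner_integral_iff)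
    then show ?thesis
      using variance_positive[of "\<lambda>\<omega>. norm (h (G \<omega>))"] by linarith
  qed
  also have "\<dots> = (\<Sum>j\<in>I. (B $ k $ j)\<^sup>2) + real (card I) * \<sigma>\<^sup>2"
    using hsq by (simp add: has_bochner_integral_iff sum.distrib)
  also have "(\<Sum>j\<in>I. (B $ k $ j)\<^sup>2) \<le> (\<Sum>j\<in>UNIV. (B $ k $ j)\<^sup>2)"
    by (rule sum_mono2) auto
  also have "\<dots> = (norm (B $ k))\<^sup>2"
    by (simp add: norm_vec_def L2_set_def sum_nonneg)
  finally have Eh: "expectation (\<lambda>\<omega>. norm (h (G \<omega>))) \<le> sqrt ((norm (B $ k))\<^sup>2 + real (card I) * \<sigma>\<^sup>2)"
    by (intro real_le_rsqrt) simp
  have "prob {\<omega> \<in> space M. (mask K (G \<omega>), mask L (G \<omega>)) \<in> ?E} \<le>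
      expectation (\<lambda>\<omega>. (\<lambda>c. C * norm (h c)) (mask L (G \<omega>)))"
  proof (rule prob_indep_var_le)
    show "indep_var borel (\<lambda>\<omega>. mask K (G \<omega>)) borel (\<lambda>\<omega>. mask L (G \<omega>))"
      by (rule indep_var_mask[OF G]) (use \<open>k \<notin> I\<close> in \<open>auto simp: K_def L_def\<close>)
    show "?E \<in> sets (borel \<Otimes>\<^sub>M borel)"
      by (rule sets_large_solution_vimage) measurable
    fix c :: "real ^ 'n::_ ^ 'n::_"
    have "large_solution I y (B + mask K (G \<omega>)) (h c) \<longleftrightarrow> large_solution I y (B + G \<omega>) (h c)" for \<omega>
      by (rule large_solution_cong) (auto simp: mask_def K_def)
    then have "prob {\<omega> \<in> space M. (mask K (G \<omega>), c) \<in> ?E} = prob {\<omega> \<in> space M. large_solution I y (B + G \<omega>) (h c)}"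
      by (simp add: space_pair_measure)
    also have "\<dots> \<le> 2 * (norm (h c) / y) / (sqrt (2 * pi) * \<sigma>)"
      by (rule prob_large_solution_fixed[OF G]) (use assms in \<open>auto simp: h_def\<close>)
    also have "\<dots> = C * norm (h c)"
      by (simp add: C_def)
    finally show "prob {\<omega> \<in> space M. (mask K (G \<omega>), c) \<in> ?E} \<le> C * norm (h c)" .
  qed (simp add: hL int_h)
  also have "\<dots> = C * expectation (\<lambda>\<omega>. norm (h (G \<omega>)))"
    by (simp add: hL)
  also have "\<dots> \<le> C * sqrt ((norm (B $ k))\<^sup>2 + real (card I) * \<sigma>\<^sup>2)"
    using C Eh by (intro mult_left_mono) auto
  also have "\<dots> = 2 * sqrt ((norm (B $ k))\<^sup>2 + real (card I) * \<sigma>\<^sup>2) / (y * (sqrt (2 * pi) * \<sigma>))"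
    by (simp add: C_def)
  also have "{\<omega> \<in> space M. (mask K (G \<omega>), mask L (G \<omega>)) \<in> ?E} =
      {\<omega> \<in> space M. large_solution I y (B + G \<omega>) ((B + G \<omega>) $ k)}"
  proof -
    have "large_solution I y (B + mask K X) (h X) \<longleftrightarrow> large_solution I y (B + X) ((B + X) $ k)" for X
      by (rule large_solution_cong) (auto simp: mask_def K_def h_def)
    then show ?thesis
      by (simp add: space_pair_measure hL)
  qed
  finally show ?thesis .
qed

end

section \<open>Row norms, index counts and the union bound\<close>

lemma norm_row_le_onorm:
  fixes A :: "real ^ 'n ^ 'm"
  shows "norm (A $ k) \<le> onorm ((*v) A)"
proof -
  \<comment> \<open>Testing the operator norm on the row itself makes one coordinate of the image
    equal to the squared length of the row.\<close>
  have "(norm (A $ k))\<^sup>2 = (A *v (A $ k)) $ k"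
    by (simp add: matrix_vector_mult_def power2_norm_eq_inner inner_vec_def)
  also have "\<dots> \<le> norm (A *v (A $ k))"
    using component_le_norm_cart abs_le_D1 by blast
  also have "\<dots> \<le> onorm ((*v) A) * norm (A $ k)"
    by (rule onorm) simp
  finally have "norm (A $ k) * norm (A $ k) \<le> onorm ((*v) A) * norm (A $ k)"
    by (simp add: power2_eq_square)
  moreover have "0 \<le> onorm ((*v) A)"
    by (rule onorm_pos_le) simp
  ultimately show ?thesis
    by (cases "norm (A $ k) = 0") auto
qed

text \<open>Double counting: initial and final segments have the same total size, and for each
  \<open>k\<close> the two segments cover the index set and overlap in \<open>k\<close>
  alone.\<close>

lemma sum_card_atMost: "2 * (\<Sum>k\<in>(UNIV :: 'n::{finite,linorder} set). card {..k}) = CARD('n) * (CARD('n) + 1)"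
proof -
  have card: "card {k. P k} = (\<Sum>i\<in>UNIV. if P i then 1 else 0)" for P :: "'n \<Rightarrow> bool"
    by (simp flip: sum.inter_filter)
  have "(\<Sum>k\<in>UNIV. card {i :: 'n. i \<le> k}) = (\<Sum>k\<in>UNIV. card {i :: 'n. k \<le> i})"
    unfolding card by (rule sum.swap)
  moreover have "(\<Sum>k\<in>UNIV. card {i :: 'n. i \<le> k}) + (\<Sum>k\<in>UNIV. card {i :: 'n. k \<le> i}) =
      (\<Sum>k\<in>(UNIV :: 'n set). CARD('n) + 1)"
    unfolding sum.distrib[symmetric]
  proof (rule sum.cong[OF refl])
    fix k :: 'n
    have "{i. i \<le> k} \<union> {i. k \<le> i} = UNIV" "{i. i \<le> k} \<inter> {i. k \<le> i} = {k}"
      by auto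
    then show "card {i. i \<le> k} + card {i. k \<le> i} = CARD('n) + 1"
      using card_Un_Int[of "{i. i \<le> k}" "{i. k \<le> i}"] by simp
  qed
  ultimately have "2 * (\<Sum>k\<in>UNIV. card {i :: 'n. i \<le> k}) = CARD('n) * (CARD('n) + 1)"
    by simp
  then show ?thesis
    by (simp add: atMost_def)
qed

theorem theorem4p1:
  fixes M :: "'a measure"
    and Abar :: "real ^ 'n::{finite,wellorder} ^ 'n::_"
    and A :: "'a \<Rightarrow> real ^ 'n::_ ^ 'n::_"
    and \<sigma> x :: real
  assumes "prob_space M"
    and "onorm (matrix_vector_mult Abar) \<le> 1"
    and "0 < \<sigma>" and "\<sigma>\<^sup>2 \<le> 1"
    and "gaussian_perturbation M \<sigma> Abar A"
    and "0 < x"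
  shows "measure M {\<omega> \<in> space M. growth_factor_U (A \<omega>) > 1 + x}
           < 1 / sqrt (2 * pi) * (real CARD('n) * (real CARD('n) + 1) / (x * \<sigma>))"
proof -
  interpret prob_space M by fact
  obtain G where AG: "\<And>\<omega>. \<omega> \<in> space M \<Longrightarrow> A \<omega> = Abar + G \<omega>" and G: "centered_gaussian M \<sigma> G"
    using assms(5) by (auto simp: gaussian_perturbation_def)
  define y where "y k = x / sqrt (card {..<k})" for k :: 'n
  \<comment> \<open>The least index is excluded: its block is empty, and \<open>y k\<close> would be
    0 there by division by zero.\<close>
  define K where "K = {k :: 'n. {..<k} \<noteq> {}}"
  define C where "C = 2 / (x * (sqrt (2 * pi) * \<sigma>))"
  have C: "0 < C"
    using assms by (simp add: C_def)
  let ?E = "\<lambda>k. {\<omega> \<in> space M. large_solution {..<k} (y k) (Abar + G \<omega>) ((Abar + G \<omega>) $ k)}"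
  have E: "?E k \<in> events" for k
  proof (rule sets_large_solution_vimage)
    have [measurable]: "(\<lambda>\<omega>. Abar + G \<omega>) \<in> borel_measurable M"
      using centered_gaussian_measurable[OF G] by simp
    then show "(\<lambda>\<omega>. Abar + G \<omega>) \<in> borel_measurable M" .
    show "(\<lambda>\<omega>. (Abar + G \<omega>) $ k) \<in> borel_measurable M"
      by measurable
  qed
  have "measure M {\<omega> \<in> space M. growth_factor_U (A \<omega>) > 1 + x} \<le> prob (\<Union>k\<in>K. ?E k)"
  proof (rule finite_measure_mono)
    show "{\<omega> \<in> space M. growth_factor_U (A \<omega>) > 1 + x} \<subseteq> (\<Union>k\<in>K. ?E k)"
    proof safe
      fix \<omega> assume \<omega>: "\<omega> \<in> space M" and "growth_factor_U (A \<omega>) > 1 + x"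
      then obtain k where "{..<k} \<noteq> {}" and "large_solution {..<k} (x / sqrt (card {..<k})) (A \<omega>) (A \<omega> $ k)"
        using growth_factor_U_large_imp \<open>0 < x\<close> by metis
      then show "\<omega> \<in> (\<Union>k\<in>K. ?E k)"
        using \<omega> AG by (auto simp: y_def K_def)
    qed
  qed (use E in auto)
  also have "\<dots> \<le> (\<Sum>k\<in>K. prob (?E k))"
    using E by (intro finite_measure_subadditive_finite) auto
  \<comment> \<open>With \<open>d = card {..<k}\<close> the summand is
    \<open>C * (d + 1 / 2)\<close>, as \<open>{..k}\<close> has one more element.\<close>
  also have "\<dots> \<le> (\<Sum>k\<in>K. C * (card {..k} - 1 / 2))"
  proof (rule sum_mono)
    fix k assume "k \<in> K"
    let ?d = "real (card {..<k})"
    have d: "0 < ?d"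
      using \<open>k \<in> K\<close> by (simp add: K_def card_gt_0_iff)
    have card: "real (card {..k}) = ?d + 1"
      by (simp flip: lessThan_Suc_atMost ivl_disj_un_singleton(2))
    have "prob (?E k) \<le> 2 * sqrt ((norm (Abar $ k))\<^sup>2 + ?d * \<sigma>\<^sup>2) / (y k * (sqrt (2 * pi) * \<sigma>))"
      using \<open>k \<in> K\<close> assms d by (intro prob_large_solution_row[OF G]) (auto simp: K_def y_def)
    also have "\<dots> = C * (sqrt ?d * sqrt ((norm (Abar $ k))\<^sup>2 + ?d * \<sigma>\<^sup>2))"
      by (simp add: C_def y_def)
    also have "sqrt ?d * sqrt ((norm (Abar $ k))\<^sup>2 + ?d * \<sigma>\<^sup>2) \<le> sqrt ?d * sqrt (1 + ?d)"
    proof -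
      have "norm (Abar $ k) \<le> 1"
        using norm_row_le_onorm assms(2) order_trans by blast
      then have "(norm (Abar $ k))\<^sup>2 \<le> 1"
        by (simp add: power_le_one)
      moreover have "?d * \<sigma>\<^sup>2 \<le> ?d * 1"
        using assms(4) by (intro mult_left_mono) auto
      ultimately show ?thesis
        by (intro mult_left_mono) auto
    qed
    \<comment> \<open>The inequality of arithmetic and geometric means, which leaves the slack of
      1/2 below \<open>card {..k}\<close>.\<close>
    also have "sqrt ?d * sqrt (1 + ?d) \<le> (?d + (1 + ?d)) / 2"
      using arith_geo_mean_sqrt[of ?d "1 + ?d"] by (simp add: real_sqrt_mult)
    finally show "prob (?E k) \<le> C * (card {..k} - 1 / 2)"
      using C by (simp add: card field_simps)
  qed
  also have "\<dots> \<le> (\<Sum>k\<in>(UNIV :: 'n set). C * (card {..k} - 1 / 2))"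
  proof (rule sum_mono2)
    fix k :: 'n
    have "1 \<le> card {..k}"
      by (simp add: Suc_le_eq card_gt_0_iff)
    then show "0 \<le> C * (card {..k} - 1 / 2)"
      using C by (intro mult_nonneg_nonneg) auto
  qed auto
  \<comment> \<open>Strictness comes from giving up the 1/2 in every term of a nonempty sum.\<close>
  also have "\<dots> < (\<Sum>k\<in>(UNIV :: 'n set). C * card {..k})"
    using C by (intro sum_strict_mono) auto
  also have "\<dots> = C / 2 * real (2 * (\<Sum>k\<in>(UNIV :: 'n set). card {..k}))"
    by (simp flip: sum_distrib_left)
  also have "\<dots> = 1 / sqrt (2 * pi) * (real CARD('n) * (real CARD('n) + 1) / (x * \<sigma>))"
    unfolding sum_card_atMost by (simp add: C_def field_simps)
  finally show ?thesis .
qed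

end
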